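(* Let $f$ be a Keller map with a component $V$ of its finiteness variety, let $\Gamma$ be the associated divisor mapping onto $V$, and let $m,N$ be the integers of the associated $u$-$\gamma$ representation (see context). Put $K=N-2m$. For generic rotations $\mathcal{L}$ of $Y_0$ (with $f$ replaced by $\mathcal{L}\circ f$), $K$ is the ramification index of $\Gamma/V$, i.e. the ramification index of the extension of discrete valuation rings $\mathcal{O}_V\subset\mathcal{O}_\Gamma$.
   Context: Work over $\mathbf{C}$. $f=(f_1,f_2):X_0=\mathbf{A}^2\to Y_0=\mathbf{A}^2$ is a Keller map (polynomial, Jacobian determinant identically $1$). $V_f\subset Y_0$ is the set of points over which $f$ is not proper, and $V$ is an irreducible (codimension one) component. $X=\mathbf{P}^2\supset X_0$. $\hat X\to X$ is a composition of point blowups over the line at infinity, and $\Gamma\subset \hat X$ is an irreducible curve over infinity such that $f$ extends to a rational map on $\hat X$ that is defined almost everywhere on $\Gamma$ and maps $\Gamma$ densely onto $V$. Coordinates are chosen so that $\Gamma$ maps to a point $[1:\alpha:0]$ of the line at infinity. $\mathcal{O}_V\subset\mathbf{C}(Y_0)$ and $\mathcal{O}_\Gamma\subset\mathbf{C}(X_0)$ are the discrete valuation rings of the divisors $V$ and $\Gamma$; via $f$, $\mathcal{O}_V\subset\mathcal{O}_\Gamma$. The $u$-$\gamma$ representation: $m\ge1$ is the order of vanishing of $1/x_1$ along $\Gamma$. Choose locally near a generic point of $\Gamma$ a function $s$ with $s^m=1/x_1$, and expand $x_2/x_1=\sum_{i\ge0}\beta_i s^i$ with $\beta_i$ local functions on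 $\Gamma$. $N$ is the first index with $\beta_N$ nonconstant. With $h_i=\beta_i\in\mathbf{C}$ for $i<N$, $\gamma$ the parameter given by $\beta_N$ and $u=s^{-1}$, the representation is $x_1=u^m$, $x_2=\sum_{i=0}^{N-1}h_iu^{m-i}+\gamma u^{m-N}$. A rotation of $Y_0$ means a linear rotation of the plane $Y_0$ (element of $SO_2$); composing with it preserves the Keller condition. *)

theory Defs
  imports "HOL-Analysis.Analysis" "HOL-Computational_Algebra.Computational_Algebra"
begin

section \<open>Polynomials and rational functions in two variables\<close>

text \<open>
  An element of \<^typ>\<open>complex poly poly\<close> is a polynomial in \<open>z\<^sub>1, z\<^sub>2\<close>: the variable of the
  coefficients is \<open>z\<^sub>1\<close>, the outer variable is \<open>z\<^sub>2\<close>. Its field of fractions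
  \<^typ>\<open>complex poly poly fract\<close> is the rational function field of the affine plane.
\<close>

definition Z1 :: "complex poly poly" where "Z1 = [:[:0, 1:]:]"

definition Z2 :: "complex poly poly" where "Z2 = [:0, 1:]"

definition eval2 :: "complex poly poly \<Rightarrow> complex ^ 2 \<Rightarrow> complex" where
  "eval2 A z = poly (poly A [:z $ 2:]) (z $ 1)"

text \<open>Substitution of \<open>u, v\<close> for \<open>z\<^sub>1, z\<^sub>2\<close>, with \<open>k\<close> the embedding of the constants.\<close>

definition subst2 :: "(complex \<Rightarrow> 'a::comm_ring_1) \<Rightarrow> complex poly poly \<Rightarrow> 'a \<Rightarrow> 'a \<Rightarrow> 'a" where
  "subst2 k A u v = poly (map_poly (\<lambda>c. poly (map_poly k c) u) A) v"

definition subst_poly ::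
    "complex poly poly \<Rightarrow> complex poly poly \<Rightarrow> complex poly poly \<Rightarrow> complex poly poly" where
  "subst_poly = subst2 (\<lambda>c. [:[:c:]:])"

definition subst_fract ::
    "complex poly poly \<Rightarrow> complex poly poly fract \<Rightarrow> complex poly poly fract
      \<Rightarrow> complex poly poly fract" where
  "subst_fract = subst2 (\<lambda>c. to_fract [:[:c:]:])"

definition has_value :: "complex poly poly fract \<Rightarrow> complex ^ 2 \<Rightarrow> complex \<Rightarrow> bool" where
  "has_value r z w \<longleftrightarrow>
     (\<exists>A B. eval2 B z \<noteq> 0 \<and> r = Fract A B \<and> w = eval2 A z / eval2 B z)"


section \<open>Zariski topology and curves in the affine plane\<close>

definition zariski_closure :: "(complex ^ 2) set \<Rightarrow> (complex ^ 2) set" where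
  "zariski_closure E = {y. \<forall>A. (\<forall>z\<in>E. eval2 A z = 0) \<longrightarrow> eval2 A y = 0}"

definition zariski_closed :: "(complex ^ 2) set \<Rightarrow> bool" where
  "zariski_closed E \<longleftrightarrow> zariski_closure E = E"

definition zariski_irreducible :: "(complex ^ 2) set \<Rightarrow> bool" where
  "zariski_irreducible E \<longleftrightarrow> E \<noteq> {} \<and>
     (\<forall>E1 E2. zariski_closed E1 \<and> zariski_closed E2 \<and> E \<subseteq> E1 \<union> E2 \<longrightarrow> E \<subseteq> E1 \<or> E \<subseteq> E2)"

definition irreducible_component :: "(complex ^ 2) set \<Rightarrow> (complex ^ 2) set \<Rightarrow> bool" where
  "irreducible_component E V \<longleftrightarrow>
     V \<subseteq> E \<and> zariski_closed V \<and> zariski_irreducible V \<and>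
     (\<forall>W. V \<subseteq> W \<and> W \<subseteq> E \<and> zariski_closed W \<and> zariski_irreducible W \<longrightarrow> W = V)"

definition irreducible_curve :: "(complex ^ 2) set \<Rightarrow> bool" where
  "irreducible_curve C \<longleftrightarrow> (\<exists>g. irreducible g \<and> C = {z. eval2 g z = 0})"

definition local_ring :: "(complex ^ 2) set \<Rightarrow> complex poly poly fract set" where
  "local_ring C = {Fract A B | A B. \<exists>z\<in>C. eval2 B z \<noteq> 0}"


section \<open>Extensions of discrete valuation rings\<close>

definition ring_units :: "'a::field set \<Rightarrow> 'a set" where
  "ring_units R = {x \<in> R. x \<noteq> 0 \<and> inverse x \<in> R}"

definition uniformizer :: "'a::field set \<Rightarrow> 'a \<Rightarrow> bool" where
  "uniformizer R p \<longleftrightarrow> p \<in> R \<and> p \<noteq> 0 \<and> p \<notin> ring_units R \<and>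
     (\<forall>x\<in>R. x \<noteq> 0 \<longrightarrow> (\<exists>n. \<exists>u\<in>ring_units R. x = u * p ^ n))"

definition dvr :: "'a::field set \<Rightarrow> bool" where
  "dvr R \<longleftrightarrow> 0 \<in> R \<and> 1 \<in> R \<and> (\<forall>x\<in>R. \<forall>y\<in>R. x - y \<in> R \<and> x * y \<in> R) \<and> (\<exists>p. uniformizer R p)"

definition has_order :: "'a::field set \<Rightarrow> 'a \<Rightarrow> nat \<Rightarrow> bool" where
  "has_order R x n \<longleftrightarrow> (\<exists>p. uniformizer R p \<and> (\<exists>u\<in>ring_units R. x = u * p ^ n))"

text \<open>\<open>e\<close> is the ramification index of the extension \<open>A \<subseteq> B\<close> given by \<open>\<phi>\<close>.\<close>

definition ramification_index :: "('a::field \<Rightarrow> 'b::field) \<Rightarrow> 'a set \<Rightarrow> 'b set \<Rightarrow> nat \<Rightarrow> bool" where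
  "ramification_index \<phi> A B e \<longleftrightarrow>
     dvr A \<and> dvr B \<and> \<phi> ` A \<subseteq> B \<and> \<phi> ` (A - ring_units A) \<subseteq> B - ring_units B \<and>
     (\<exists>p. uniformizer A p \<and> has_order B (\<phi> p) e)"


section \<open>Keller maps and the points of non-properness\<close>

definition keller_map :: "complex poly poly ^ 2 \<Rightarrow> bool" where
  "keller_map f \<longleftrightarrow>
     map_poly pderiv (f $ 1) * pderiv (f $ 2) - pderiv (f $ 1) * map_poly pderiv (f $ 2) = 1"

definition map_of_polys :: "complex poly poly ^ 2 \<Rightarrow> complex ^ 2 \<Rightarrow> complex ^ 2" where
  "map_of_polys f x = (\<chi> i. eval2 (f $ i) x)"

definition nonproper_set :: "complex poly poly ^ 2 \<Rightarrow> (complex ^ 2) set" where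
  "nonproper_set f =
     {y. \<not> (\<exists>U. open U \<and> y \<in> U \<and>
           proper_map (top_of_set (map_of_polys f -` U)) (top_of_set U) (map_of_polys f))}"

text \<open>The composition of the linear map \<open>L\<close> of the target plane with \<open>f\<close>.\<close>

definition linear_comp :: "complex ^ 2 ^ 2 \<Rightarrow> complex poly poly ^ 2 \<Rightarrow> complex poly poly ^ 2" where
  "linear_comp L f = (\<chi> i. \<Sum>j\<in>UNIV. smult [:L $ i $ j:] (f $ j))"


section \<open>Iterated point blowups of the projective plane over the line at infinity\<close>

text \<open>
  The points \<open>[1:\<alpha>:0]\<close> lie in the affine chart of the projective plane with coordinates
  \<open>(1/x\<^sub>1, x\<^sub>2/x\<^sub>1)\<close>. The blowup of a point \<open>a\<close> of an affine chart is covered by two affine planes,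
  mapped to that chart by \<open>(p, q) \<mapsto> (a\<^sub>1 + p, a\<^sub>2 + p q)\<close> and \<open>(p, q) \<mapsto> (a\<^sub>1 + p q, a\<^sub>2 + q)\<close>.
  A chart of an iterated blowup is recorded by the pair of polynomials \<open>S, T\<close> which express
  \<open>1/x\<^sub>1\<close> and \<open>x\<^sub>2/x\<^sub>1\<close> in its coordinates. Only points over the line at infinity, i.e. points with
  \<open>S = 0\<close>, are blown up. Blowups at points outside a chart do not change it.
\<close>

inductive blowup_chart :: "complex poly poly \<Rightarrow> complex poly poly \<Rightarrow> bool" where
  base: "blowup_chart Z1 Z2"
| blowup1: "blowup_chart S T \<Longrightarrow> eval2 S a = 0 \<Longrightarrow>
    blowup_chart (subst_poly S ([:[:a $ 1:]:] + Z1) ([:[:a $ 2:]:] + Z1 * Z2))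
                 (subst_poly T ([:[:a $ 1:]:] + Z1) ([:[:a $ 2:]:] + Z1 * Z2))"
| blowup2: "blowup_chart S T \<Longrightarrow> eval2 S a = 0 \<Longrightarrow>
    blowup_chart (subst_poly S ([:[:a $ 1:]:] + Z1 * Z2) ([:[:a $ 2:]:] + Z2))
                 (subst_poly T ([:[:a $ 1:]:] + Z1 * Z2) ([:[:a $ 2:]:] + Z2))"

text \<open>
  The trace on the chart of an irreducible curve over infinity which is contracted to a point
  \<open>[1:\<alpha>:0]\<close>.
\<close>

definition curve_over_infinity ::
    "complex poly poly \<Rightarrow> complex poly poly \<Rightarrow> (complex ^ 2) set \<Rightarrow> bool" where
  "curve_over_infinity S T \<Gamma> \<longleftrightarrow>
     irreducible_curve \<Gamma> \<and> (\<forall>z\<in>\<Gamma>. eval2 S z = 0) \<and> (\<exists>\<alpha>. \<forall>z\<in>\<Gamma>. eval2 T z = \<alpha>)"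

text \<open>
  The map \<open>f\<close> as a pair of rational functions on the chart, using \<open>x\<^sub>1 = 1/S\<close>, \<open>x\<^sub>2 = T/S\<close>. The
  chart is birational to the source plane, and the function field of the source plane is
  identified with that of the chart.
\<close>

definition extend_map ::
    "complex poly poly \<Rightarrow> complex poly poly \<Rightarrow> complex poly poly ^ 2
      \<Rightarrow> complex poly poly fract ^ 2" where
  "extend_map S T f =
     (\<chi> i. subst_fract (f $ i) (1 / to_fract S) (to_fract T / to_fract S))"

text \<open>Meaningful for dominant \<open>F\<close>, i.e. when no nonzero polynomial vanishes at \<open>F\<close>; the quotient is then independent
  of \<open>A, B\<close>.\<close>

definition pullback ::
    "complex poly poly fract ^ 2 \<Rightarrow> complex poly poly fract \<Rightarrow> complex poly poly fract" where
  "pullback F r =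
     (THE q. \<exists>A B. B \<noteq> 0 \<and> r = Fract A B \<and>
               q = subst_fract A (F $ 1) (F $ 2) / subst_fract B (F $ 1) (F $ 2))"

definition image_of_curve ::
    "complex poly poly fract ^ 2 \<Rightarrow> (complex ^ 2) set \<Rightarrow> (complex ^ 2) set" where
  "image_of_curve F \<Gamma> = {y. \<exists>z\<in>\<Gamma>. \<forall>i. has_value (F $ i) z (y $ i)}"

definition maps_densely_onto ::
    "complex poly poly fract ^ 2 \<Rightarrow> (complex ^ 2) set \<Rightarrow> (complex ^ 2) set \<Rightarrow> bool" where
  "maps_densely_onto F \<Gamma> V \<longleftrightarrow>
     (\<forall>i. F $ i \<in> local_ring \<Gamma>) \<and> zariski_closure (image_of_curve F \<Gamma>) = V"


section \<open>The representation in terms of \<open>u\<close> and \<open>\<gamma>\<close>\<close>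

text \<open>
  Local holomorphic coordinates \<open>(s, t)\<close> on an open set \<open>U\<close> of the chart, onto a product of discs,
  with \<open>\<Gamma> = {s = 0}\<close> in \<open>U\<close>. The restriction of \<open>t\<close> to \<open>\<Gamma>\<close> is a local coordinate on \<open>\<Gamma>\<close>.
\<close>

definition adapted_coordinates ::
    "(complex ^ 2) set \<Rightarrow> (complex ^ 2) set \<Rightarrow> (complex ^ 2 \<Rightarrow> complex) \<Rightarrow> (complex ^ 2 \<Rightarrow> complex)
      \<Rightarrow> complex set \<Rightarrow> bool" where
  "adapted_coordinates \<Gamma> U s t D \<longleftrightarrow>
     open U \<and>
     (\<forall>z\<in>U. \<exists>a b c d. (s has_derivative (\<lambda>h. a * h $ 1 + b * h $ 2)) (at z) \<and>
                      (t has_derivative (\<lambda>h. c * h $ 1 + d * h $ 2)) (at z) \<and>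
                      a * d - b * c \<noteq> 0) \<and>
     (\<exists>r>0. \<exists>c. \<exists>\<rho>>0. D = ball c \<rho> \<and> bij_betw (\<lambda>z. (s z, t z)) U (ball 0 r \<times> D)) \<and>
     \<Gamma> \<inter> U = {z\<in>U. s z = 0}"

text \<open>
  With \<open>s\<^sup>m = 1/x\<^sub>1\<close>, \<open>x\<^sub>2/x\<^sub>1\<close> is expanded in powers of \<open>s\<close>; the coefficients \<open>\<beta> i\<close> are holomorphic
  functions on the open set \<open>\<Gamma> \<inter> U\<close> of \<open>\<Gamma>\<close>, written in the coordinate \<open>t\<close>. The representation is
  then given by \<open>u = 1/s\<close>, \<open>h i = \<beta> i\<close> for \<open>i < N\<close> and \<open>\<gamma> = \<beta> N + (terms divisible by s)\<close>.
\<close>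

definition u_gamma_representation ::
    "complex poly poly \<Rightarrow> complex poly poly \<Rightarrow> (complex ^ 2) set \<Rightarrow> nat \<Rightarrow> nat \<Rightarrow> bool" where
  "u_gamma_representation S T \<Gamma> m N \<longleftrightarrow>
     1 \<le> m \<and> has_order (local_ring \<Gamma>) (to_fract S) m \<and>
     (\<exists>U s t D \<beta>.
        adapted_coordinates \<Gamma> U s t D \<and>
        (\<forall>z\<in>U. s z ^ m = eval2 S z) \<and>
        (\<forall>i. \<beta> i holomorphic_on D) \<and>
        (\<forall>z\<in>U. (\<lambda>i. \<beta> i (t z) * s z ^ i) sums eval2 T z) \<and>
        (\<forall>i<N. \<beta> i constant_on D) \<and>
        \<not> \<beta> N constant_on D)"

end

theory Submission
  imports Defs "HOL-Computational_Algebra.Field_as_Ring" "HOL-Complex_Analysis.Complex_Analysis"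
begin

text \<open>
  Let \<open>G\<close> and \<open>v\<close> be equations of \<open>\<Gamma>\<close> and \<open>V\<close>, let \<open>F\<close> be the extension of \<open>f\<close> to the chart, and let \<open>e\<close> be
  the order of \<open>h = v(F)\<close> along \<open>\<Gamma>\<close>. By the Keller condition \<open>dF\<^sub>1 \<and> dF\<^sub>2\<close> is \<open>dx\<^sub>1 \<and> dx\<^sub>2\<close>, which vanishes to
  order \<open>N - 2m - 1\<close> along \<open>\<Gamma>\<close>: in coordinates \<open>(s, t)\<close> with \<open>x\<^sub>1 = s\<^sup>-\<^sup>m\<close> the determinant is
  \<open>\<partial>x\<^sub>1/\<partial>s \<cdot> \<partial>x\<^sub>2/\<partial>t = - m s\<^sup>-\<^sup>m\<^sup>-\<^sup>1 \<cdot> s\<^sup>N\<^sup>-\<^sup>m (\<beta>'\<^sub>N(t) + O(s))\<close>. On the other hand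
  \<open>dF\<^sub>1 \<and> dh = v\<^sub>2(F) dF\<^sub>1 \<and> dF\<^sub>2\<close>, where \<open>v\<^sub>2 = \<partial>v/\<partial>y\<^sub>2\<close>, vanishes to order \<open>e - 1\<close> if \<open>v\<^sub>2\<close> does not
  vanish on \<open>V\<close>, because then \<open>F\<^sub>1\<close> is not constant on \<open>\<Gamma>\<close>; otherwise exchange the two coordinates. Hence
  \<open>e = N - 2m\<close>. In particular \<open>h \<noteq> 0\<close>, so \<open>F\<close> is dominant and \<open>e\<close> is the ramification index. The
  hypotheses are invariant under rotations of the target, so no rotation is exceptional.
\<close>

text \<open>Orders are compared along one analytic arc \<open>\<zeta>\<close> that meets
  \<open>\<Gamma>\<close> at a generic point and has \<open>S = s ^ m\<close> on it. In chart
  coordinates \<open>dx_1\<close> wedge \<open>dx_2\<close> is \<open>-dS\<close> wedge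
  \<open>dT\<close> over \<open>S ^ 3\<close>, and \<open>dS\<close> wedge \<open>dT\<close> has
  order \<open>m - 1 + N\<close>; so the equation to be solved is
  \<open>m - 1 + N = 3 * m + (e - 1)\<close>. The order of \<open>G\<close> on the arc is known only
  through \<open>S * B' = A' * G ^ m\<close> with \<open>A'\<close>, \<open>B'\<close> nonzero at
  the base point, so the comparison is made between \<open>m\<close>-th powers. That
  \<open>F_i\<close> is not constant on \<open>\<Gamma>\<close> is needed in the form that
  \<open>dF_i\<close> wedge \<open>dG\<close> does not vanish identically there. If it did,
  \<open>F_i\<close> would be a constant \<open>k\<close> along \<open>\<Gamma>\<close>, so
  \<open>y_i - k\<close> would vanish on \<open>V\<close> and \<open>v\<close> would divide it; the
  partial derivative of \<open>v\<close> in the other variable would then vanish on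
  \<open>V\<close>, against the choice of \<open>i\<close>. Density of the image shows only that
  polynomials not divisible by \<open>v\<close> pull back to units. That \<open>v\<close> itself
  does not pull back to zero has to be extracted from the wedge identity before its order
  \<open>e\<close> makes sense.\<close>

no_notation fps_nth (infixl "$" 75)

section \<open>Polynomials in two variables\<close>

lemma eval2_simps [simp]:
  "eval2 0 z = 0" "eval2 1 z = 1" "eval2 (A + B) z = eval2 A z + eval2 B z"
  "eval2 (A - B) z = eval2 A z - eval2 B z" "eval2 (- A) z = - eval2 A z"
  "eval2 (A * B) z = eval2 A z * eval2 B z" "eval2 (A ^ n) z = eval2 A z ^ n"
  "eval2 [:[:c:]:] z = c" "eval2 Z1 z = z $ 1" "eval2 Z2 z = z $ 2"
  by (simp_all add: eval2_def Z1_def Z2_def)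

lemma eval2_pCons: "eval2 (pCons a A) z = poly a (z $ 1) + z $ 2 * eval2 A z"
  by (simp add: eval2_def)

lemma eval2_fibre: "eval2 A z = poly (map_poly (\<lambda>c. poly c (z $ 1)) A) (z $ 2)"
  by (induction A) (simp_all add: eval2_pCons map_poly_pCons)

lemma vec2_eq_iff: "(x :: 'a ^ 2) = y \<longleftrightarrow> x $ 1 = y $ 1 \<and> x $ 2 = y $ 2"
  by (simp add: vec_eq_iff forall_2)

section \<open>Zero sets of irreducible polynomials in the plane\<close>

lemma linear_factor_dvd:
  assumes "map_poly (\<lambda>c. poly c a) A = 0"
  shows "[:[:-a, 1:]:] dvd (A :: complex poly poly)"
proof (subst const_poly_dvd_iff, intro allI)
  fix n
  have "poly (coeff A n) a = coeff (map_poly (\<lambda>c. poly c a) A) n"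
    by (simp add: coeff_map_poly)
  then show "[:-a, 1:] dvd coeff A n"
    using assms by (simp add: poly_eq_0_iff_dvd)
qed

lemma linear_factor_not_unit: "\<not> [:[:- a, 1:]:] dvd (1 :: complex poly poly)"
  by (simp add: is_unit_const_poly_iff is_unit_pCons_iff)

lemma irreducible_dvd_factor:
  assumes "irreducible (G :: complex poly poly)" "H dvd G" "\<not> H dvd 1"
  shows "G dvd H"
  using assms by (metis dvd_def dvd_mult_unit_iff irreducibleD' dvd_refl)

text \<open>A nonzero element \<open>R\<close> of least \<open>z\<^sub>2\<close>-degree in the ideal of \<open>G\<close> and \<open>P\<close> divides, up to a factor
  free of \<open>z\<^sub>2\<close>, both \<open>G\<close> and \<open>P\<close> (pseudo-division), so it is itself free of \<open>z\<^sub>2\<close>.\<close>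

lemma eliminate_second_variable:
  assumes irr: "irreducible (G :: complex poly poly)" and deg: "degree G > 0" and nd: "\<not> G dvd P"
  obtains A B c where "c \<noteq> 0" "A * G + B * P = [:c:]"
proof -
  define I where "I = {R. R \<noteq> 0 \<and> (\<exists>A B. R = A * G + B * P)}"
  have pe: "prime_elem G" using irr by (rule irreducible_imp_prime_elem)
  have "G \<noteq> 0" using deg by auto
  then have "G \<in> I" unfolding I_def by (auto intro: exI[of _ 1] exI[of _ 0])
  then obtain R where R: "R \<in> I" and min: "\<And>R'. R' \<in> I \<Longrightarrow> degree R \<le> degree R'"
    by (metis ex_has_least_nat[of "\<lambda>R. R \<in> I" G degree])
  then obtain A B where RAB: "R = A * G + B * P" and R0: "R \<noteq> 0" by (auto simp: I_def)
  have div: "\<exists>c Q. c \<noteq> 0 \<and> [:c:] * F = R * Q" if F: "F = A' * G + B' * P" for F A' B'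
  proof -
    obtain Q R' where QR: "pseudo_divmod F R = (Q, R')" by force
    define c where "c = coeff R (degree R) ^ (Suc (degree F) - degree R)"
    have c: "c \<noteq> 0" using R0 by (simp add: c_def)
    have *: "smult c F = R * Q + R'" "R' = 0 \<or> degree R' < degree R"
      using pseudo_divmod[OF R0 QR] by (simp_all add: c_def)
    have "R' = ([:c:] * A' - Q * A) * G + ([:c:] * B' - Q * B) * P"
      using *(1) by (simp add: F RAB algebra_simps smult_add_right)
    then have "R' = 0" using *(2) min[of R'] unfolding I_def by force
    then show ?thesis using * c by (intro exI[of _ c] exI[of _ Q]) auto
  qed
  obtain c Q where cQ: "c \<noteq> 0" "[:c:] * G = R * Q" using div[of G 1 0] by auto
  obtain c' Q' where cQ': "c' \<noteq> 0" "[:c':] * P = R * Q'" using div[of P 0 1] by auto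
  have nc: "\<not> G dvd [:d:]" if "d \<noteq> 0" for d
    using that deg by (metis degree_pCons_0 dvd_imp_degree_le not_less pCons_eq_0_iff)
  \<comment> \<open>Primality of \<open>G\<close> leaves two cases. \<open>G dvd R\<close> would
    pass to \<open>[:c':] * P\<close> and hence to \<open>P\<close>; \<open>G dvd Q\<close> uses up
    the whole degree of \<open>G\<close> in the second variable, leaving none for
    \<open>R\<close>.\<close>
  have "G dvd R * Q" using cQ(2) by (metis dvd_triv_right)
  then consider "G dvd R" | "G dvd Q" using pe prime_elem_dvd_mult_iff by blast
  then show thesis
  proof cases
    case 1
    then have "G dvd [:c':] * P" using cQ'(2) by auto
    then show thesis using nc[OF cQ'(1)] nd prime_elem_dvd_mult_iff[OF pe] by blast
  next
    case 2
    have Q0: "Q \<noteq> 0" using cQ \<open>G \<noteq> 0\<close> by (metis mult_eq_0_iff mult_zero_right pCons_eq_0_iff)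
    have "degree G = degree R + degree Q"
      using arg_cong[OF cQ(2), of degree] cQ(1) R0 Q0 \<open>G \<noteq> 0\<close> by (simp add: degree_mult_eq)
    moreover have "degree G \<le> degree Q" using 2 Q0 by (rule dvd_imp_degree_le)
    ultimately have "degree R = 0" by simp
    then obtain d where "R = [:d:]" by (rule degree_eq_zeroE)
    then show thesis using that R0 RAB by (metis pCons_0_0)
  qed
qed

text \<open>Elimination leaves finitely many first coordinates. A fibre over one of them is infinite
  only if both polynomials vanish on the whole vertical line; the equation of that line would then
  divide \<open>G\<close>, hence be associated to it, and \<open>G\<close> would divide
  \<open>P\<close>.\<close>

lemma finite_common_zeros:
  assumes irr: "irreducible G" and nd: "\<not> G dvd P"
  shows "finite {z. eval2 G z = 0 \<and> eval2 P z = 0}"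
proof -
  let ?E = "{z. eval2 G z = 0 \<and> eval2 P z = 0}"
  have "\<exists>c. c \<noteq> 0 \<and> (\<forall>z\<in>?E. poly c (z $ 1) = 0)"
  proof (cases "degree G = 0")
    case True
    then obtain c where c: "G = [:c:]" by (rule degree_eq_zeroE)
    moreover have "c \<noteq> 0" using irr c by auto
    ultimately show ?thesis by (intro exI[of _ c]) (auto simp: eval2_pCons)
  next
    case False
    then have "degree G > 0" by simp
    then obtain A B c where c: "c \<noteq> 0" "A * G + B * P = [:c:]"
      using nd by (rule eliminate_second_variable[OF irr])
    have "poly c (z $ 1) = 0" if "z \<in> ?E" for z
      using that arg_cong[OF c(2), of "\<lambda>A. eval2 A z"] by (simp add: eval2_pCons)
    then show ?thesis using c by blast
  qed
  then obtain c where c: "c \<noteq> 0" "\<And>z. z \<in> ?E \<Longrightarrow> poly c (z $ 1) = 0" by blast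
  have fibre: "finite {b. poly (map_poly (\<lambda>c. poly c a) G) b = 0 \<and> poly (map_poly (\<lambda>c. poly c a) P) b = 0}"
    (is "finite ?F") for a
  proof -
    have "map_poly (\<lambda>c. poly c a) G \<noteq> 0 \<or> map_poly (\<lambda>c. poly c a) P \<noteq> 0"
    proof (rule ccontr)
      assume "\<not> ?thesis"
      then have "[:[:-a, 1:]:] dvd G" "[:[:-a, 1:]:] dvd P" using linear_factor_dvd by auto
      then show False
        using irreducible_dvd_factor[OF irr] linear_factor_not_unit nd dvd_trans by blast
    qed
    then show ?thesis
      using poly_roots_finite by (metis (no_types, lifting) finite_subset mem_Collect_eq subsetI)
  qed
  let ?f = "\<lambda>(a, b). (vector [a, b] :: complex ^ 2)"
  have "?E \<subseteq> ?f ` (SIGMA a : {a. poly c a = 0}. {b. poly (map_poly (\<lambda>c. poly c a) G) b = 0 \<and> poly (map_poly (\<lambda>c. poly c a) P) b = 0})"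
  proof
    fix z assume z: "z \<in> ?E"
    have "z = ?f (z $ 1, z $ 2)" by (simp add: vec2_eq_iff)
    then show "z \<in> ?f ` (SIGMA a : {a. poly c a = 0}. {b. poly (map_poly (\<lambda>c. poly c a) G) b = 0 \<and> poly (map_poly (\<lambda>c. poly c a) P) b = 0})"
      using z c(2)[OF z] by (intro image_eqI[of _ _ "(z $ 1, z $ 2)"]) (auto simp: eval2_fibre)
  qed
  moreover have "finite {a. poly c a = 0}" using c(1) by (rule poly_roots_finite)
  ultimately show ?thesis using fibre by (meson finite_SigmaI finite_imageI finite_subset)
qed

text \<open>If \<open>G\<close> is free of the second variable, its zero set contains a vertical
  line. Otherwise every first coordinate at which the leading coefficient does not vanish lifts to a
  zero, because the field is algebraically closed.\<close>

lemma infinite_zeros_irreducible: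
  assumes irr: "irreducible G"
  shows "infinite {z. eval2 G z = 0}"
proof (cases "degree G = 0")
  case True
  then obtain c where c: "G = [:c:]" by (rule degree_eq_zeroE)
  have "degree c \<noteq> 0"
  proof
    assume "degree c = 0"
    then obtain d where "c = [:d:]" by (rule degree_eq_zeroE)
    with c irr show False by (auto simp: irreducible_def is_unit_const_poly_iff dvd_field_iff)
  qed
  then obtain a where a: "poly c a = 0"
    using fundamental_theorem_of_algebra_alt[of c] by (metis degree_pCons_0)
  have "inj (\<lambda>b. vector [a, b] :: complex ^ 2)" by (rule injI) (simp add: vec2_eq_iff)
  then have "infinite (range (\<lambda>b. vector [a, b] :: complex ^ 2))"
    using finite_imageD infinite_UNIV_char_0 by blast
  moreover have "range (\<lambda>b. vector [a, b]) \<subseteq> {z. eval2 G z = 0}"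
    by (auto simp: c a eval2_pCons)
  ultimately show ?thesis using finite_subset by blast
next
  case False
  then have lc: "lead_coeff G \<noteq> 0" by auto
  have "- {a. poly (lead_coeff G) a = 0} \<subseteq> (\<lambda>z. z $ 1) ` {z. eval2 G z = 0}"
  proof
    fix a assume "a \<in> - {a. poly (lead_coeff G) a = 0}"
    then have "coeff (map_poly (\<lambda>c. poly c a) G) (degree G) \<noteq> 0"
      by (simp add: coeff_map_poly)
    then have "degree (map_poly (\<lambda>c. poly c a) G) \<noteq> 0"
      using False le_degree by fastforce
    then obtain b where b: "poly (map_poly (\<lambda>c. poly c a) G) b = 0"
      using fundamental_theorem_of_algebra_alt by (metis degree_pCons_0)
    then show "a \<in> (\<lambda>z. z $ 1) ` {z. eval2 G z = 0}"
      by (intro image_eqI[of _ _ "vector [a, b]"]) (auto simp: eval2_fibre)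
  qed
  moreover have "infinite (- {a. poly (lead_coeff G) a = 0})"
    using poly_roots_finite[OF lc] by (simp add: Compl_eq_Diff_UNIV infinite_UNIV_char_0)
  ultimately show ?thesis using finite_subset by blast
qed

text \<open>The Nullstellensatz for a plane curve: if \<open>P\<close> vanishes on the infinite zero
  set of \<open>G\<close>, the common zeros are too many for \<open>G\<close> not to divide
  \<open>P\<close>.\<close>

lemma irreducible_dvd_iff_vanishes:
  assumes "irreducible G"
  shows "G dvd P \<longleftrightarrow> (\<forall>z. eval2 G z = 0 \<longrightarrow> eval2 P z = 0)"
proof
  assume "\<forall>z. eval2 G z = 0 \<longrightarrow> eval2 P z = 0"
  then have "{z. eval2 G z = 0 \<and> eval2 P z = 0} = {z. eval2 G z = 0}" by auto
  then show "G dvd P"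
    using finite_common_zeros[OF assms] infinite_zeros_irreducible[OF assms] by metis
qed auto

text \<open>A nonzero derivative has smaller degree than \<open>G\<close> and cannot be a multiple
  of it, and in characteristic zero both partial derivatives vanish only for a constant.\<close>

lemma irreducible_not_dvd_partials:
  assumes irr: "irreducible (G :: complex poly poly)"
  shows "\<not> G dvd pderiv G \<or> \<not> G dvd map_poly pderiv G"
proof (rule ccontr)
  assume "\<not> ?thesis"
  then have d: "G dvd pderiv G" "G dvd map_poly pderiv G" by auto
  have "degree G = 0"
  proof (rule ccontr)
    assume "degree G \<noteq> 0"
    then have "pderiv G \<noteq> 0" "degree (pderiv G) < degree G"
      by (auto simp: pderiv_eq_0_iff degree_pderiv)
    with d(1) show False using dvd_imp_degree_le leD by blast
  qed
  then obtain c where c: "G = [:c:]" by (rule degree_eq_zeroE)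
  have "c dvd pderiv c" using d(2) by (simp add: c map_poly_pCons const_poly_dvd_const_poly_iff)
  moreover have "degree c \<noteq> 0"
  proof
    assume "degree c = 0"
    then obtain d where "c = [:d:]" by (rule degree_eq_zeroE)
    with c irr show False by (auto simp: irreducible_def is_unit_const_poly_iff dvd_field_iff)
  qed
  then have "pderiv c \<noteq> 0" "degree (pderiv c) < degree c"
    by (auto simp: pderiv_eq_0_iff degree_pderiv)
  ultimately show False using dvd_imp_degree_le leD by blast
qed


section \<open>Values of rational functions\<close>

lemma has_value_unique:
  assumes "has_value r z w" "has_value r z w'"
  shows "w = w'"
proof -
  obtain A B A' B' where *: "eval2 B z \<noteq> 0" "r = Fract A B" "w = eval2 A z / eval2 B z"
    "eval2 B' z \<noteq> 0" "r = Fract A' B'" "w' = eval2 A' z / eval2 B' z"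
    using assms unfolding has_value_def by blast
  then have "B \<noteq> 0" "B' \<noteq> 0" by auto
  then have "A * B' = A' * B" using * by (simp add: eq_fract)
  then have "eval2 A z * eval2 B' z = eval2 A' z * eval2 B z" by (metis eval2_simps(6))
  then show ?thesis using * by (simp add: frac_eq_eq)
qed

lemma has_value_Fract: "eval2 B z \<noteq> 0 \<Longrightarrow> has_value (Fract A B) z (eval2 A z / eval2 B z)"
  unfolding has_value_def by blast

lemma has_value_to_fract: "has_value (to_fract A) z (eval2 A z)"
  using has_value_Fract[of 1 z A] by (simp add: to_fract_def)

lemma has_value_add:
  assumes "has_value r z w" "has_value r' z w'"
  shows "has_value (r + r') z (w + w')"
proof -
  obtain A B A' B' where *: "eval2 B z \<noteq> 0" "r = Fract A B" "w = eval2 A z / eval2 B z"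
    "eval2 B' z \<noteq> 0" "r' = Fract A' B'" "w' = eval2 A' z / eval2 B' z"
    using assms unfolding has_value_def by blast
  then have "B \<noteq> 0" "B' \<noteq> 0" by auto
  then show ?thesis
    using * unfolding has_value_def
    by (intro exI[of _ "A * B' + A' * B"] exI[of _ "B * B'"]) (simp add: field_simps)
qed

lemma has_value_mult:
  assumes "has_value r z w" "has_value r' z w'"
  shows "has_value (r * r') z (w * w')"
proof -
  obtain A B A' B' where *: "eval2 B z \<noteq> 0" "r = Fract A B" "w = eval2 A z / eval2 B z"
    "eval2 B' z \<noteq> 0" "r' = Fract A' B'" "w' = eval2 A' z / eval2 B' z"
    using assms unfolding has_value_def by blast
  then show ?thesis
    unfolding has_value_def
    by (intro exI[of _ "A * A'"] exI[of _ "B * B'"]) simp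
qed

lemma has_value_power: "has_value r z w \<Longrightarrow> has_value (r ^ n) z (w ^ n)"
  by (induction n) (use has_value_to_fract[of 1] in \<open>simp_all add: has_value_mult\<close>)

lemma has_value_inverse:
  assumes "has_value r z w" "w \<noteq> 0"
  shows "has_value (inverse r) z (inverse w)"
proof -
  obtain A B where *: "eval2 B z \<noteq> 0" "r = Fract A B" "w = eval2 A z / eval2 B z"
    using assms unfolding has_value_def by blast
  then show ?thesis
    using assms(2) unfolding has_value_def by (intro exI[of _ B] exI[of _ A]) auto
qed

lemma has_value_divide:
  assumes "has_value r z w" "has_value r' z w'" "w' \<noteq> 0"
  shows "has_value (r / r') z (w / w')"
  using has_value_mult[OF assms(1) has_value_inverse[OF assms(2,3)]] by (simp add: divide_inverse)

lemma subst2_pCons: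
  assumes "k 0 = 0"
  shows "subst2 k (pCons c A) u v = poly (map_poly k c) u + v * subst2 k A u v"
  by (simp add: subst2_def map_poly_pCons assms)

lemma subst2_0 [simp]: "subst2 k 0 u v = 0"
  by (simp add: subst2_def)

lemma has_value_subst_fract:
  assumes "has_value r1 z w1" "has_value r2 z w2"
  shows "has_value (subst_fract A r1 r2) z (eval2 A (vector [w1, w2]))"
proof -
  let ?k = "\<lambda>c. to_fract [:[:c:]:]"
  have coeff: "has_value (poly (map_poly ?k c) r1) z (poly c w1)" for c
  proof (induction c)
    case 0
    then show ?case using has_value_to_fract[of 0] by simp
  next
    case (pCons a c)
    have "has_value (?k a + r1 * poly (map_poly ?k c) r1) z (a + w1 * poly c w1)"
      using has_value_add[OF has_value_to_fract[of "[:[:a:]:]"] has_value_mult[OF assms(1) pCons.IH]]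
      by simp
    then show ?case by (simp add: map_poly_pCons)
  qed
  show ?thesis
    unfolding subst_fract_def
  proof (induction A)
    case 0
    then show ?case using has_value_to_fract[of 0] by simp
  next
    case (pCons c A)
    show ?case
      using has_value_add[OF coeff[of c] has_value_mult[OF assms(2) pCons.IH]]
      by (simp add: subst2_pCons eval2_pCons)
  qed
qed


section \<open>The local ring of a curve\<close>

lemma local_ring_eq:
  assumes "irreducible G"
  shows "local_ring {z. eval2 G z = 0} = {Fract A B | A B. \<not> G dvd B}"
  using irreducible_dvd_iff_vanishes[OF assms] unfolding local_ring_def by blast

text \<open>Concrete form of the units of the local ring; \<open>ring_units_local_ring\<close>
  identifies the two.\<close>

definition units_at :: "complex poly poly \<Rightarrow> complex poly poly fract set" where
  "units_at G = {Fract A B | A B. \<not> G dvd A \<and> \<not> G dvd B}"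

lemma to_fract_power: "to_fract (A ^ n) = to_fract A ^ n"
  by (induction n) simp_all

locale curve =
  fixes G :: "complex poly poly"
  assumes irr: "irreducible G"
begin

abbreviation "R \<equiv> local_ring {z. eval2 G z = 0}"
abbreviation "g \<equiv> to_fract G"

lemma prime: "prime_elem G"
  using irr by (rule irreducible_imp_prime_elem)

lemma G_nonzero [simp]: "G \<noteq> 0" and g_nonzero [simp]: "g \<noteq> 0"
  using irr by auto

lemma not_dvd_1 [simp]: "\<not> G dvd 1"
  using irr irreducible_not_unit by blast

lemma not_dvd_mult: "\<not> G dvd A \<Longrightarrow> \<not> G dvd B \<Longrightarrow> \<not> G dvd A * B"
  using prime by (simp add: prime_elem_dvd_mult_iff)

lemma not_dvd_nonzero: "\<not> G dvd A \<Longrightarrow> A \<noteq> 0"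
  by auto

lemma units_at_nonzero: "u \<in> units_at G \<Longrightarrow> u \<noteq> 0"
  by (auto simp: units_at_def Zero_fract_def eq_fract dest: not_dvd_nonzero)

lemma units_atI: "\<not> G dvd A \<Longrightarrow> \<not> G dvd B \<Longrightarrow> Fract A B \<in> units_at G"
  unfolding units_at_def by blast

lemma local_ringI: "\<not> G dvd B \<Longrightarrow> Fract A B \<in> R"
  unfolding local_ring_eq[OF irr] by blast

lemma units_at_1: "1 \<in> units_at G"
  unfolding One_fract_def by (intro units_atI not_dvd_1)

lemma units_at_mult: "u \<in> units_at G \<Longrightarrow> v \<in> units_at G \<Longrightarrow> u * v \<in> units_at G"
  unfolding units_at_def using not_dvd_mult by (force simp: mult_fract)

lemma units_at_inverse: "u \<in> units_at G \<Longrightarrow> inverse u \<in> units_at G"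
  unfolding units_at_def by force

lemma units_at_power: "u \<in> units_at G \<Longrightarrow> u ^ n \<in> units_at G"
  by (induction n) (simp_all add: units_at_1 units_at_mult)

lemma units_at_subset: "units_at G \<subseteq> R"
  unfolding units_at_def local_ring_eq[OF irr] by blast

lemma dvd_if_unit_times_power:
  assumes "Fract A B = u * g ^ n" "u \<in> units_at G" "\<not> G dvd B" "n > 0"
  shows "G dvd A"
proof -
  obtain C D where CD: "u = Fract C D" "\<not> G dvd C" "\<not> G dvd D"
    using assms(2) unfolding units_at_def by blast
  have "g ^ n = Fract (G ^ n) 1" by (simp flip: to_fract_def add: to_fract_power)
  then have "Fract A B = Fract (C * G ^ n) D" using assms(1) by (simp add: CD)
  then have "A * D = C * G ^ n * B"
    using assms(3) CD(3) by (simp add: eq_fract not_dvd_nonzero)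
  then have "G dvd A * D" using assms(4) by (metis dvd_mult2 dvd_mult dvd_power)
  then show ?thesis using CD(3) prime by (simp add: prime_elem_dvd_mult_iff)
qed

text \<open>Cancelling the smaller power would equate a unit with a unit times a positive power of
  \<open>g\<close>, so \<open>G\<close> would divide the numerator of a unit. This makes the order
  along the curve well defined.\<close>

lemma unit_power_unique:
  assumes "u * g ^ a = v * g ^ b" "u \<in> units_at G" "v \<in> units_at G"
  shows "a = b"
proof -
  have eq_shift: "u = v * g ^ (b - a)" if "u * g ^ a = v * g ^ b" "a < b" for u v :: "complex poly poly fract" and a b
  proof -
    have "v * g ^ b = v * g ^ (b - a) * g ^ a"
      using that(2) by (simp add: mult.assoc flip: power_add)
    with that(1) show ?thesis by simp
  qed
  have aux: False if "u * g ^ a = v * g ^ b" "u \<in> units_at G" "v \<in> units_at G" "a < b" for u v a b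
  proof -
    note uv = that
    have "u = v * g ^ (b - a)"
      using uv(1,4) by (rule eq_shift)
    moreover obtain C D where CD: "u = Fract C D" "\<not> G dvd C" "\<not> G dvd D"
      using uv(2) unfolding units_at_def by blast
    ultimately show False
      using dvd_if_unit_times_power[of C D v "b - a"] uv(3,4) by simp
  qed
  show ?thesis using aux[of u a v b] aux[of v b u a] assms by (metis nat_neq_iff)
qed

lemma poly_decompose:
  assumes "A \<noteq> 0"
  obtains n A' where "A = G ^ n * A'" "\<not> G dvd A'"
proof -
  have "\<not> G dvd 1" by simp
  then show thesis using that assms multiplicity_decompose'[of A G] by metis
qed

lemma local_ring_decompose:
  assumes "x \<in> R" "x \<noteq> 0"
  obtains n u where "u \<in> units_at G" "x = u * g ^ n"
proof -
  obtain A B where AB: "x = Fract A B" "\<not> G dvd B"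
    using assms(1) unfolding local_ring_eq[OF irr] by blast
  then have "A \<noteq> 0" using assms(2) by (auto simp: Zero_fract_def eq_fract not_dvd_nonzero)
  then obtain n A' where A': "A = G ^ n * A'" "\<not> G dvd A'" by (rule poly_decompose)
  have "g ^ n = Fract (G ^ n) 1" by (simp flip: to_fract_def add: to_fract_power)
  then have "x = Fract A' B * g ^ n" by (simp add: AB A' mult.commute)
  then show thesis using that AB A' unfolding units_at_def by blast
qed

lemma local_ring_0: "0 \<in> R" and local_ring_1: "1 \<in> R"
  unfolding Zero_fract_def One_fract_def by (intro local_ringI not_dvd_1)+

lemma local_ring_to_fract: "to_fract A \<in> R"
  unfolding to_fract_def by (intro local_ringI not_dvd_1)

lemma local_ring_mult: "x \<in> R \<Longrightarrow> y \<in> R \<Longrightarrow> x * y \<in> R"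
  unfolding local_ring_eq[OF irr] using not_dvd_mult by force

lemma local_ring_add: "x \<in> R \<Longrightarrow> y \<in> R \<Longrightarrow> x + y \<in> R"
  unfolding local_ring_eq[OF irr] using not_dvd_mult not_dvd_nonzero
  by clarsimp (metis add_fract)

lemma local_ring_diff: "x \<in> R \<Longrightarrow> y \<in> R \<Longrightarrow> x - y \<in> R"
  unfolding local_ring_eq[OF irr] using not_dvd_mult not_dvd_nonzero
  by clarsimp (metis diff_fract)

lemma ring_units_local_ring: "ring_units R = units_at G"
proof (intro equalityI subsetI)
  fix x assume x: "x \<in> ring_units R"
  then have *: "x \<in> R" "inverse x \<in> R" "x \<noteq> 0" by (auto simp: ring_units_def)
  obtain n u where u: "u \<in> units_at G" "x = u * g ^ n" using local_ring_decompose *(1,3) .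
  obtain k v where v: "v \<in> units_at G" "inverse x = v * g ^ k"
    using local_ring_decompose *(2,3) by (metis inverse_nonzero_iff_nonzero)
  have "u * v * g ^ (n + k) = 1 * g ^ 0"
    using u v *(3) by (metis (no_types, opaque_lifting) mult.assoc mult.left_commute mult_1 power_0 power_add right_inverse)
  then have "n + k = 0" 
    by (rule unit_power_unique) (use u v units_at_1 units_at_mult in auto)
  then show "x \<in> units_at G" using u by simp
next
  fix x assume "x \<in> units_at G"
  then show "x \<in> ring_units R"
    using units_at_subset units_at_inverse units_at_nonzero unfolding ring_units_def by blast
qed

lemma uniformizer_g: "uniformizer R g"
proof -
  have "g \<notin> units_at G"
    using unit_power_unique[of g 0 1 1] units_at_1 by auto
  then show ?thesis
    unfolding uniformizer_def ring_units_local_ring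
    using local_ring_to_fract local_ring_decompose g_nonzero by metis
qed

lemma uniformizer_unit_times_g:
  assumes "uniformizer R p"
  obtains u where "u \<in> units_at G" "p = u * g"
proof -
  have p: "p \<in> R" "p \<noteq> 0" "p \<notin> units_at G"
    and *: "\<And>x. x \<in> R \<Longrightarrow> x \<noteq> 0 \<Longrightarrow> \<exists>n. \<exists>u\<in>units_at G. x = u * p ^ n"
    using assms unfolding uniformizer_def ring_units_local_ring by auto
  obtain n u where u: "u \<in> units_at G" "p = u * g ^ n" using local_ring_decompose p(1,2) .
  obtain k v where v: "v \<in> units_at G" "g = v * p ^ k"
    using *[of g] local_ring_to_fract by auto
  \<comment> \<open>Each of \<open>p\<close> and \<open>g\<close> is a unit times a power of the
    other, with exponents \<open>n\<close> and \<open>k\<close>; substituting one relation into the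
    other gives \<open>n * k = 1\<close>.\<close>
  have "(v * u ^ k) * g ^ (n * k) = 1 * g ^ 1"
  proof -
    have "g = v * (u * g ^ n) ^ k" using u(2) v(2) by argo
    then show ?thesis by (simp add: power_mult_distrib power_mult mult.assoc)
  qed
  then have "n * k = 1" 
    by (rule unit_power_unique) (use u v units_at_1 units_at_mult units_at_power in auto)
  then have "n = 1" by simp
  then show thesis using that u by simp
qed

lemma has_order_iff: "has_order R x n \<longleftrightarrow> (\<exists>u\<in>units_at G. x = u * g ^ n)"
proof
  assume "has_order R x n"
  then obtain p u where p: "uniformizer R p" "u \<in> units_at G" "x = u * p ^ n"
    unfolding has_order_def ring_units_local_ring by blast
  obtain v where v: "v \<in> units_at G" "p = v * g" using uniformizer_unit_times_g[OF p(1)] .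
  have "x = (u * v ^ n) * g ^ n" by (simp add: p v power_mult_distrib)
  then show "\<exists>u\<in>units_at G. x = u * g ^ n"
    using p v units_at_mult units_at_power by blast
next
  assume "\<exists>u\<in>units_at G. x = u * g ^ n"
  then show "has_order R x n"
    unfolding has_order_def ring_units_local_ring using uniformizer_g by blast
qed

lemma dvr_local_ring: "dvr R"
  unfolding dvr_def
  using local_ring_0 local_ring_1 local_ring_diff local_ring_mult uniformizer_g by blast

text \<open>The value may be computed from another fraction than the one exhibiting \<open>x\<close>
  as an element of the ring. Cross-multiplication carries divisibility by \<open>G\<close> from one
  numerator to the other.\<close>

lemma has_value_nonunit:
  assumes "x \<in> R" "x \<notin> units_at G" "eval2 G z = 0" "has_value x z w"
  shows "w = 0"
proof -
  obtain A B where AB: "x = Fract A B" "\<not> G dvd B"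
    using assms(1) unfolding local_ring_eq[OF irr] by blast
  then have "G dvd A" using assms(2) unfolding units_at_def by blast
  obtain C D where CD: "eval2 D z \<noteq> 0" "x = Fract C D" "w = eval2 C z / eval2 D z"
    using assms(4) unfolding has_value_def by blast
  then have "D \<noteq> 0" by auto
  then have "A * D = C * B" using AB CD by (simp add: eq_fract not_dvd_nonzero)
  then have "G dvd C * B" using \<open>G dvd A\<close> by (metis dvd_mult2)
  then have "G dvd C" using AB(2) prime by (simp add: prime_elem_dvd_mult_iff)
  then have "eval2 C z = 0" using assms(3) irreducible_dvd_iff_vanishes[OF irr] by blast
  then show ?thesis using CD by simp
qed

text \<open>The numerator and the denominator of a unit each meet the curve in finitely many points.
  As the curve is infinite, good points remain.\<close>

lemma finite_zeros_unit:
  assumes "x \<in> units_at G"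
  shows "finite {z. eval2 G z = 0 \<and> \<not> (\<exists>w. w \<noteq> 0 \<and> has_value x z w)}"
proof -
  obtain A B where AB: "x = Fract A B" "\<not> G dvd A" "\<not> G dvd B"
    using assms unfolding units_at_def by blast
  have "{z. eval2 G z = 0 \<and> \<not> (\<exists>w. w \<noteq> 0 \<and> has_value x z w)} \<subseteq>
    {z. eval2 G z = 0 \<and> eval2 A z = 0} \<union> {z. eval2 G z = 0 \<and> eval2 B z = 0}"
    using has_value_Fract[of B _ A] by (auto simp: AB(1)) (metis divide_eq_0_iff)
  then show ?thesis
    using finite_common_zeros[OF irr] AB(2,3) finite_subset by (meson finite_UnI)
qed

end


section \<open>Partial derivatives\<close>

abbreviation D1 :: "complex poly poly \<Rightarrow> complex poly poly" where "D1 \<equiv> map_poly pderiv"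
abbreviation D2 :: "complex poly poly \<Rightarrow> complex poly poly" where "D2 \<equiv> pderiv"

lemma D1_pCons: "D1 (pCons c A) = pCons (pderiv c) (D1 A)"
  by (simp add: map_poly_pCons)

lemma D1_add: "D1 (A + B) = D1 A + D1 B"
  by (rule poly_eqI) (simp add: coeff_map_poly pderiv_add)

lemma D1_smult: "D1 (smult c A) = smult (pderiv c) A + smult c (D1 A)"
  by (rule poly_eqI) (simp add: coeff_map_poly pderiv_mult mult.commute add.commute)

lemma D1_mult: "D1 (A * B) = D1 A * B + A * D1 B"
  by (induction A) (simp_all add: D1_pCons D1_add D1_smult algebra_simps)

text \<open>The derivative is required to be complex linear, so \<open>a\<close> and
  \<open>b\<close> are the holomorphic partial derivatives and are determined by
  \<open>h\<close>.\<close>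

definition has_grad :: "(complex ^ 2 \<Rightarrow> complex) \<Rightarrow> complex \<Rightarrow> complex \<Rightarrow> complex ^ 2 \<Rightarrow> bool" where
  "has_grad h a b z \<longleftrightarrow> (h has_derivative (\<lambda>v. a * v $ 1 + b * v $ 2)) (at z)"

lemma has_grad_unique:
  assumes "has_grad h a b z" "has_grad h a' b' z"
  shows "a = a' \<and> b = b'"
proof -
  have "(\<lambda>v :: complex ^ 2. a * v $ 1 + b * v $ 2) = (\<lambda>v. a' * v $ 1 + b' * v $ 2)"
    using assms unfolding has_grad_def by (rule has_derivative_unique)
  from fun_cong[OF this, of "vector [1, 0]"] fun_cong[OF this, of "vector [0, 1]"]
  show ?thesis by simp
qed

lemma has_grad_transform:
  assumes "has_grad h a b z" "open X" "z \<in> X" "\<And>w. w \<in> X \<Longrightarrow> h w = h' w"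
  shows "has_grad h' a b z"
  using assms unfolding has_grad_def by (rule has_derivative_transform_within_open)

lemma has_grad_const: "has_grad (\<lambda>_. c) 0 0 z"
  by (simp add: has_grad_def)

lemma has_grad_proj: "has_grad (\<lambda>z. z $ 1) 1 0 z" "has_grad (\<lambda>z. z $ 2) 0 1 z"
  unfolding has_grad_def
  by (simp_all add: bounded_linear_imp_has_derivative[OF bounded_linear_vec_nth])

lemma has_grad_add:
  assumes "has_grad h a b z" "has_grad k c d z"
  shows "has_grad (\<lambda>z. h z + k z) (a + c) (b + d) z"
  using has_derivative_add[OF assms[unfolded has_grad_def]]
  unfolding has_grad_def by (simp add: algebra_simps)

lemma has_grad_mult:
  assumes "has_grad h a b z" "has_grad k c d z"
  shows "has_grad (\<lambda>z. h z * k z) (a * k z + h z * c) (b * k z + h z * d) z"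
  using has_derivative_mult[OF assms[unfolded has_grad_def]]
  unfolding has_grad_def by (simp add: algebra_simps)

lemma has_grad_compose:
  assumes "has_grad h a b z" "(p has_field_derivative p') (at (h z))"
  shows "has_grad (\<lambda>z. p (h z)) (p' * a) (p' * b) z"
  using has_derivative_compose[OF assms(1)[unfolded has_grad_def]
      assms(2)[unfolded has_field_derivative_def]]
  unfolding has_grad_def by (simp add: algebra_simps)

lemma has_grad_power:
  assumes "has_grad h a b z"
  shows "has_grad (\<lambda>z. h z ^ n) (of_nat n * h z ^ (n - 1) * a) (of_nat n * h z ^ (n - 1) * b) z"
  by (rule has_grad_compose[OF assms]) (auto intro!: derivative_eq_intros)

lemma has_grad_divide:
  assumes "has_grad h a b z" "has_grad k c d z" "k z \<noteq> 0"
  shows "has_grad (\<lambda>z. h z / k z) ((a * k z - h z * c) / k z ^ 2) ((b * k z - h z * d) / k z ^ 2) z"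
proof -
  have "(inverse has_field_derivative - (inverse (k z) ^ Suc (Suc 0))) (at (k z))"
    by (rule DERIV_inverse) (fact assms(3))
  then have "has_grad (\<lambda>z. inverse (k z)) (- (inverse (k z) ^ 2) * c) (- (inverse (k z) ^ 2) * d) z"
    using has_grad_compose[OF assms(2), of inverse "- (inverse (k z) ^ Suc (Suc 0))"]
    by (simp only: numeral_2_eq_2)
  note grad = has_grad_mult[OF assms(1) this]
  have "x * inverse (k z) + h z * (- (inverse (k z) ^ 2) * y) = (x * k z - h z * y) / k z ^ 2" for x y
    using assms(3) by (simp add: divide_simps power2_eq_square)
  then show ?thesis
    using grad by (simp only: divide_inverse[of "h _" "k _"])
qed

lemma has_grad_poly_compose:
  assumes "has_grad h a b z" "has_grad k c d z"
  shows "has_grad (\<lambda>z. eval2 A (vector [h z, k z]))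
    (eval2 (D1 A) (vector [h z, k z]) * a + eval2 (D2 A) (vector [h z, k z]) * c)
    (eval2 (D1 A) (vector [h z, k z]) * b + eval2 (D2 A) (vector [h z, k z]) * d) z"
proof (induction A)
  case 0
  then show ?case using has_grad_const[of 0] by simp
next
  case (pCons p A)
  have "has_grad (\<lambda>z. poly p (h z)) (poly (pderiv p) (h z) * a) (poly (pderiv p) (h z) * b) z"
    using assms(1) poly_DERIV by (rule has_grad_compose)
  from has_grad_add[OF this has_grad_mult[OF assms(2) pCons.IH]] show ?case
    by (simp add: eval2_pCons D1_pCons pderiv_pCons algebra_simps)
qed

lemma has_grad_eval2: "has_grad (eval2 A) (eval2 (D1 A) z) (eval2 (D2 A) z) z"
proof -
  have "vector [w $ 1, w $ 2] = w" for w :: "complex ^ 2" by (simp add: vec2_eq_iff)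
  then show ?thesis using has_grad_poly_compose[OF has_grad_proj, of A z] by simp
qed

lemma continuous_on_eval2: "continuous_on X (eval2 A)"
  using has_grad_eval2[of A] unfolding has_grad_def
  by (meson continuous_at_imp_continuous_on has_derivative_continuous)

lemma tendsto_eval2: "(h \<longlongrightarrow> z) F \<Longrightarrow> ((\<lambda>x. eval2 A (h x)) \<longlongrightarrow> eval2 A z) F"
  using has_derivative_continuous[OF has_grad_eval2[of A z, unfolded has_grad_def]]
    isCont_tendsto_compose by blast

lemma open_eval2_nonzero: "open {z. eval2 A z \<noteq> 0}"
  using open_Collect_neq[OF continuous_on_eval2 continuous_on_const] .

text \<open>Compares orders at 0 of functions that are known only through their limits: after
  division by the smaller power one side tends to a nonzero number and the other to 0.\<close>

lemma exponents_eq: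
  fixes u v :: "complex \<Rightarrow> complex"
  assumes "(u \<longlongrightarrow> c) (at 0)" "(v \<longlongrightarrow> d) (at 0)" "c \<noteq> 0" "d \<noteq> 0"
    and "\<forall>\<^sub>F s in at 0. s ^ a * u s = s ^ b * v s"
  shows "a = b"
proof -
  have aux: False if "(u \<longlongrightarrow> c) (at 0)" "(v \<longlongrightarrow> d) (at 0)" "c \<noteq> 0" "a < b"
    "\<forall>\<^sub>F s in at 0. s ^ a * u s = s ^ b * v s" for u v :: "complex \<Rightarrow> complex" and c d a b
  proof -
    have "\<forall>\<^sub>F s in at 0. s ^ (b - a) * v s = u s"
      using that(5) eventually_neq_at_within[of 0 0 UNIV]
    proof eventually_elim
      case (elim s)
      then have "s ^ a * u s = s ^ a * (s ^ (b - a) * v s)"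
        using that(4) by (simp add: mult.assoc[symmetric] flip: power_add)
      then show ?case using elim(2) by simp
    qed
    moreover have "((\<lambda>s. s ^ (b - a) * v s) \<longlongrightarrow> 0 ^ (b - a) * d) (at 0)"
      by (intro tendsto_intros that)
    ultimately have "(u \<longlongrightarrow> 0) (at 0)"
      using that(4) tendsto_cong by (fastforce simp: power_0_left)
    then show False using that(1,3) tendsto_unique trivial_limit_at by blast
  qed
  have sym: "\<forall>\<^sub>F s in at 0. s ^ b * v s = s ^ a * u s"
    using assms(5) by eventually_elim simp
  show ?thesis
    using aux[OF assms(1,2,3) _ assms(5)] aux[OF assms(2,1,4) _ sym] by (metis nat_neq_iff)
qed


section \<open>The Jacobian determinant along a curve at infinity\<close>

definition jac_poly :: "complex poly poly \<Rightarrow> complex poly poly \<Rightarrow> complex poly poly" where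
  "jac_poly S T = D1 S * D2 T - D2 S * D1 T"

text \<open>\<open>a1\<close>, \<open>b1\<close> and \<open>a2\<close>, \<open>b2\<close> are the
  gradients of \<open>1/S\<close> and \<open>T/S\<close>. The fraction \<open>P/Q\<close> and the
  composition with these two functions are values of the same element of the function field, so they
  agree near \<open>z\<close> and the chain rule gives the gradient of \<open>P/Q\<close>.\<close>

lemma extend_map_grad:
  assumes S: "eval2 S z \<noteq> 0"
    and F: "subst_fract A (1 / to_fract S) (to_fract T / to_fract S) = Fract P Q" "eval2 Q z \<noteq> 0"
  defines "x \<equiv> vector [1 / eval2 S z, eval2 T z / eval2 S z] :: complex ^ 2"
    and "a1 \<equiv> - eval2 (D1 S) z / eval2 S z ^ 2"
    and "b1 \<equiv> - eval2 (D2 S) z / eval2 S z ^ 2"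
    and "a2 \<equiv> (eval2 (D1 T) z * eval2 S z - eval2 T z * eval2 (D1 S) z) / eval2 S z ^ 2"
    and "b2 \<equiv> (eval2 (D2 T) z * eval2 S z - eval2 T z * eval2 (D2 S) z) / eval2 S z ^ 2"
  shows "has_grad (\<lambda>z. eval2 P z / eval2 Q z)
    (eval2 (D1 A) x * a1 + eval2 (D2 A) x * a2) (eval2 (D1 A) x * b1 + eval2 (D2 A) x * b2) z"
proof -
  have 1: "has_grad (\<lambda>z. 1 / eval2 S z) a1 b1 z"
    using has_grad_divide[OF has_grad_const[of 1] has_grad_eval2[of S z] S] by (simp add: a1_def b1_def)
  have 2: "has_grad (\<lambda>z. eval2 T z / eval2 S z) a2 b2 z"
    using has_grad_divide[OF has_grad_eval2[of T z] has_grad_eval2[of S z] S] by (simp add: a2_def b2_def)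
  show ?thesis
  proof (rule has_grad_transform)
    show "has_grad (\<lambda>z. eval2 A (vector [1 / eval2 S z, eval2 T z / eval2 S z]))
      (eval2 (D1 A) x * a1 + eval2 (D2 A) x * a2) (eval2 (D1 A) x * b1 + eval2 (D2 A) x * b2) z"
      using has_grad_poly_compose[OF 1 2, of A] by (simp add: x_def)
    show "open ({z. eval2 S z \<noteq> 0} \<inter> {z. eval2 Q z \<noteq> 0})"
      by (intro open_Int open_eval2_nonzero)
    show "z \<in> {z. eval2 S z \<noteq> 0} \<inter> {z. eval2 Q z \<noteq> 0}" using S F by simp
    fix w assume w: "w \<in> {z. eval2 S z \<noteq> 0} \<inter> {z. eval2 Q z \<noteq> 0}"
    have "has_value (1 / to_fract S) w (1 / eval2 S w)" "has_value (to_fract T / to_fract S) w (eval2 T w / eval2 S w)"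
      using has_value_divide[OF has_value_to_fract[of 1 w] has_value_to_fract[of S w]]
        has_value_divide[OF has_value_to_fract[of T w] has_value_to_fract[of S w]] w by simp_all
    from has_value_subst_fract[OF this, of A]
    have "has_value (Fract P Q) w (eval2 A (vector [1 / eval2 S w, eval2 T w / eval2 S w]))"
      by (simp add: F)
    then show "eval2 A (vector [1 / eval2 S w, eval2 T w / eval2 S w]) = eval2 P w / eval2 Q w"
      using has_value_Fract[of Q w P] w has_value_unique by blast
  qed
qed

text \<open>Explicit quotient rule, here and in \<open>quot_grad2\<close>. Limits along the arc
  follow from continuity of polynomials, and the numerators are polynomials, so that their
  divisibility by \<open>G\<close> can be discussed.\<close>

definition quot_grad1 :: "complex poly poly \<Rightarrow> complex poly poly \<Rightarrow> complex ^ 2 \<Rightarrow> complex" where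
  "quot_grad1 P Q z = (eval2 (D1 P) z * eval2 Q z - eval2 P z * eval2 (D1 Q) z) / eval2 Q z ^ 2"

definition quot_grad2 :: "complex poly poly \<Rightarrow> complex poly poly \<Rightarrow> complex ^ 2 \<Rightarrow> complex" where
  "quot_grad2 P Q z = (eval2 (D2 P) z * eval2 Q z - eval2 P z * eval2 (D2 Q) z) / eval2 Q z ^ 2"

lemma has_grad_quot:
  "eval2 Q z \<noteq> 0 \<Longrightarrow>
    has_grad (\<lambda>z. eval2 P z / eval2 Q z) (quot_grad1 P Q z) (quot_grad2 P Q z) z"
  unfolding quot_grad1_def quot_grad2_def using has_grad_divide has_grad_eval2 by blast

lemma tendsto_quot_grad:
  assumes "(h \<longlongrightarrow> z) F" "eval2 Q z \<noteq> 0"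
  shows "((\<lambda>x. quot_grad1 P Q (h x)) \<longlongrightarrow> quot_grad1 P Q z) F"
    and "((\<lambda>x. quot_grad2 P Q (h x)) \<longlongrightarrow> quot_grad2 P Q z) F"
  unfolding quot_grad1_def quot_grad2_def using assms by (auto intro!: tendsto_intros tendsto_eval2)

text \<open>The Jacobian determinant of \<open>f\<close> is 1, so that of the extended map is the one of the source
  coordinates \<open>(1/S, T/S)\<close>.\<close>

lemma extend_map_jacobian:
  assumes keller: "keller_map f" and S: "eval2 S z \<noteq> 0"
    and F: "\<And>i. extend_map S T f $ i = Fract (P i) (Q i)" "\<And>i. eval2 (Q i) z \<noteq> 0"
  shows "quot_grad1 (P 1) (Q 1) z * quot_grad2 (P 2) (Q 2) z
    - quot_grad2 (P 1) (Q 1) z * quot_grad1 (P 2) (Q 2) z = - eval2 (jac_poly S T) z / eval2 S z ^ 3"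
proof -
  let ?x = "vector [1 / eval2 S z, eval2 T z / eval2 S z] :: complex ^ 2"
  define s s1 s2 t t1 t2 where "s = eval2 S z" and "s1 = eval2 (D1 S) z" and "s2 = eval2 (D2 S) z"
    and "t = eval2 T z" and "t1 = eval2 (D1 T) z" and "t2 = eval2 (D2 T) z"
  note defs = this
  define a1 b1 a2 b2 where "a1 = - s1 / s ^ 2" and "b1 = - s2 / s ^ 2"
    and "a2 = (t1 * s - t * s1) / s ^ 2" and "b2 = (t2 * s - t * s2) / s ^ 2"
  define p q where "p = (\<lambda>i. eval2 (D1 (f $ i)) ?x)" and "q = (\<lambda>i. eval2 (D2 (f $ i)) ?x)"
  have grad: "quot_grad1 (P i) (Q i) z = p i * a1 + q i * a2 \<and> quot_grad2 (P i) (Q i) z = p i * b1 + q i * b2" for i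
  proof -
    have "subst_fract (f $ i) (1 / to_fract S) (to_fract T / to_fract S) = Fract (P i) (Q i)"
      using F(1)[of i] by (simp add: extend_map_def)
    from has_grad_unique[OF has_grad_quot[OF F(2)] extend_map_grad[OF S this F(2)]]
    show ?thesis by (simp add: p_def q_def a1_def b1_def a2_def b2_def defs)
  qed
  have "eval2 (D1 (f $ 1) * D2 (f $ 2) - D2 (f $ 1) * D1 (f $ 2)) ?x = eval2 1 ?x"
    using keller unfolding keller_map_def by simp
  then have det: "p 1 * q 2 - q 1 * p 2 = 1" by (simp add: p_def q_def)
  have s: "s \<noteq> 0" using S by (simp add: s_def)
  \<comment> \<open>The terms containing \<open>t\<close> undifferentiated cancel, which lowers the
    denominator from \<open>S ^ 4\<close> to \<open>S ^ 3\<close>.\<close>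
  have "a1 * b2 - b1 * a2 = - (s1 * t2 - s2 * t1) / s ^ 3"
    using s unfolding a1_def b1_def a2_def b2_def by (simp add: field_simps power2_eq_square power3_eq_cube)
  moreover have "(p 1 * a1 + q 1 * a2) * (p 2 * b1 + q 2 * b2) - (p 1 * b1 + q 1 * b2) * (p 2 * a1 + q 2 * a2)
    = (p 1 * q 2 - q 1 * p 2) * (a1 * b2 - b1 * a2)" by algebra
  ultimately show ?thesis by (simp add: grad det jac_poly_def defs)
qed

text \<open>With \<open>h = v(F)\<close> for an equation \<open>v\<close> of \<open>V\<close>, both members are, up to sign, the coefficient of
  \<open>dF\<^sub>i \<and> dh\<close>; here \<open>q\<close> is the partial derivative of \<open>v\<close> in the other variable.\<close>

lemma wedge_identity:
  assumes keller: "keller_map f" and S: "eval2 S z \<noteq> 0"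
    and F: "\<And>i. extend_map S T f $ i = Fract (P i) (Q i)" "\<And>i. eval2 (Q i) z \<noteq> 0"
    and idx: "i = (1 :: 2) \<and> q = D2 v \<or> i = 2 \<and> q = D1 v"
    and h: "has_grad (\<lambda>z. eval2 v (\<chi> i. eval2 (P i) z / eval2 (Q i) z)) a b z"
  shows "(if i = 1 then -1 else 1) * eval2 q (\<chi> i. eval2 (P i) z / eval2 (Q i) z)
      * (eval2 (jac_poly S T) z / eval2 S z ^ 3)
    = quot_grad1 (P i) (Q i) z * b - quot_grad2 (P i) (Q i) z * a"
proof -
  have vec: "(\<chi> i. eval2 (P i) z / eval2 (Q i) z) = vector [eval2 (P 1) z / eval2 (Q 1) z, eval2 (P 2) z / eval2 (Q 2) z]" for z
    by (simp add: vec2_eq_iff)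
  define a1 b1 a2 b2 where "a1 = quot_grad1 (P 1) (Q 1) z" and "b1 = quot_grad2 (P 1) (Q 1) z"
    and "a2 = quot_grad1 (P 2) (Q 2) z" and "b2 = quot_grad2 (P 2) (Q 2) z"
  note defs = this
  define v1 v2 where "v1 = eval2 (D1 v) (\<chi> i. eval2 (P i) z / eval2 (Q i) z)"
    and "v2 = eval2 (D2 v) (\<chi> i. eval2 (P i) z / eval2 (Q i) z)"
  have "a = v1 * a1 + v2 * a2 \<and> b = v1 * b1 + v2 * b2"
    using has_grad_unique[OF h[unfolded vec] has_grad_poly_compose[OF has_grad_quot[OF F(2)[of 1], of "P 1"] has_grad_quot[OF F(2)[of 2], of "P 2"]]]
    unfolding v1_def v2_def defs vec .
  moreover have "a1 * b2 - b1 * a2 = - (eval2 (jac_poly S T) z / eval2 S z ^ 3)"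
    using extend_map_jacobian[OF keller S F] by (simp add: defs)
  then have J: "eval2 (jac_poly S T) z / eval2 S z ^ 3 = b1 * a2 - a1 * b2" by algebra
  \<comment> \<open>The sign: \<open>dF_1\<close> wedge \<open>dh\<close> is \<open>v2\<close> times
    \<open>dF_1\<close> wedge \<open>dF_2\<close>, while \<open>dF_2\<close> wedge \<open>dh\<close>
    is \<open>-v1\<close> times it, and \<open>dF_1\<close> wedge \<open>dF_2\<close> is itself
    \<open>-J / S ^ 3\<close>, with \<open>J\<close> the Jacobian polynomial of \<open>S\<close> and
    \<open>T\<close>.\<close>
  ultimately show ?thesis using idx unfolding J
    by (elim disjE) (simp_all add: v1_def v2_def defs algebra_simps)
qed

lemma has_value_pullback_poly:
  assumes F: "\<And>i. F $ i = Fract (P i) (Q i)" "\<And>i. eval2 (Q i) z \<noteq> 0"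
  shows "has_value (subst_fract v (F $ 1) (F $ 2)) z (eval2 v (\<chi> i. eval2 (P i) z / eval2 (Q i) z))"
proof -
  have "has_value (F $ i) z (eval2 (P i) z / eval2 (Q i) z)" for i
    using F by (simp add: has_value_Fract)
  from has_value_subst_fract[OF this[of 1] this[of 2], of v]
  show ?thesis by (simp add: vec2_eq_iff eval2_def)
qed

text \<open>\<open>\<zeta>\<close> is an arc ending at \<open>z0\<close>, parametrized so that
  \<open>S\<close> becomes \<open>s ^ m\<close>, and \<open>k\<close> is the order of
  \<open>dS\<close> wedge \<open>dT\<close> along it. The point \<open>z0\<close> is one where
  \<open>F\<close> is defined and the chosen partial derivative of \<open>v\<close> does not vanish
  at its image.\<close>

context
  fixes f :: "complex poly poly ^ 2" and S T v q :: "complex poly poly" and P Q and i :: 2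
    and z0 :: "complex ^ 2" and \<zeta> :: "complex \<Rightarrow> complex ^ 2" and m k :: nat and c :: complex
  assumes keller: "keller_map f"
    and F: "\<And>i. extend_map S T f $ i = Fract (P i) (Q i)" "\<And>i. eval2 (Q i) z0 \<noteq> 0"
    and idx: "i = (1 :: 2) \<and> q = D2 v \<or> i = 2 \<and> q = D1 v"
    and q: "eval2 q (\<chi> i. eval2 (P i) z0 / eval2 (Q i) z0) \<noteq> 0"
    and \<zeta>: "(\<zeta> \<longlongrightarrow> z0) (at 0)" "\<forall>\<^sub>F s in at 0. eval2 S (\<zeta> s) = s ^ m"
    and J: "((\<lambda>s. eval2 (jac_poly S T) (\<zeta> s) / s ^ k) \<longlongrightarrow> c) (at 0)" "c \<noteq> 0"
begin

private abbreviation "\<Phi> z \<equiv> \<chi> i. eval2 (P i) z / eval2 (Q i) z"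

lemma eventually_curve_nonzero: "eval2 B z0 \<noteq> 0 \<Longrightarrow> \<forall>\<^sub>F s in at 0. eval2 B (\<zeta> s) \<noteq> 0"
  using tendsto_eval2[OF \<zeta>(1), of B] tendsto_imp_eventually_ne by blast

lemma eventually_curve_denominators: "\<forall>\<^sub>F s in at 0. \<forall>i. eval2 (Q i) (\<zeta> s) \<noteq> 0"
  using eventually_conj[OF eventually_curve_nonzero[OF F(2)[of 1]] eventually_curve_nonzero[OF F(2)[of 2]]]
  by (simp add: forall_2)

lemma tendsto_curve_image: "((\<lambda>s. eval2 A (\<Phi> (\<zeta> s))) \<longlongrightarrow> eval2 A (\<Phi> z0)) (at 0)"
  by (intro tendsto_eval2 vec_tendstoI) (auto intro!: tendsto_intros tendsto_eval2 \<zeta> F)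

lemma curve_has_grad:
  assumes h: "subst_fract v (extend_map S T f $ 1) (extend_map S T f $ 2) = Fract A B"
    and z: "eval2 B z \<noteq> 0" "\<And>i. eval2 (Q i) z \<noteq> 0"
  shows "has_grad (\<lambda>z. eval2 v (\<Phi> z)) (quot_grad1 A B z) (quot_grad2 A B z) z"
proof (rule has_grad_transform)
  let ?X = "{z. eval2 B z \<noteq> 0} \<inter> {z. eval2 (Q 1) z \<noteq> 0} \<inter> {z. eval2 (Q 2) z \<noteq> 0}"
  show "has_grad (\<lambda>z. eval2 A z / eval2 B z) (quot_grad1 A B z) (quot_grad2 A B z) z"
    using z(1) by (rule has_grad_quot)
  show "open ?X" by (intro open_Int open_eval2_nonzero)
  show "z \<in> ?X" using z by simp
  fix w assume w: "w \<in> ?X"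
  have "eval2 (Q j) w \<noteq> 0" for j using w exhaust_2[of j] by auto
  from has_value_pullback_poly[OF F(1) this, of v]
  have "has_value (Fract A B) w (eval2 v (\<Phi> w))" by (simp only: h)
  then show "eval2 A w / eval2 B w = eval2 v (\<Phi> w)"
    using has_value_Fract[of B w A] has_value_unique w by blast
qed

text \<open>If \<open>h = v(F)\<close> were zero, then \<open>dF_i\<close> wedge \<open>dh\<close>
  would be zero as well; by the wedge identity it is, up to sign, the product of \<open>q\<close> at
  the image and \<open>J / S ^ 3\<close>, neither of which vanishes on the arc close to
  \<open>z0\<close>.\<close>

lemma pullback_equation_nonzero: "subst_fract v (extend_map S T f $ 1) (extend_map S T f $ 2) \<noteq> 0"
proof
  assume "subst_fract v (extend_map S T f $ 1) (extend_map S T f $ 2) = 0"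
  then have h: "subst_fract v (extend_map S T f $ 1) (extend_map S T f $ 2) = Fract 0 1"
    by (simp add: Zero_fract_def)
  have "\<forall>\<^sub>F s in at 0. eval2 q (\<Phi> (\<zeta> s)) \<noteq> 0"
    using tendsto_curve_image q tendsto_imp_eventually_ne by blast
  moreover have "\<forall>\<^sub>F s in at 0. eval2 (jac_poly S T) (\<zeta> s) / s ^ k \<noteq> 0"
    using J tendsto_imp_eventually_ne by blast
  ultimately have "\<forall>\<^sub>F s in at (0 :: complex). False"
    using eventually_curve_denominators \<zeta>(2) eventually_neq_at_within[of 0 0 UNIV]
  proof eventually_elim
    case (elim s)
    have "has_grad (\<lambda>z. eval2 v (\<Phi> z)) 0 0 (\<zeta> s)"
      using curve_has_grad[OF h, of "\<zeta> s"] elim(3) by (simp add: quot_grad1_def quot_grad2_def)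
    moreover have "eval2 S (\<zeta> s) \<noteq> 0" using elim(4,5) by simp
    ultimately have "eval2 q (\<Phi> (\<zeta> s)) * (eval2 (jac_poly S T) (\<zeta> s) / eval2 S (\<zeta> s) ^ 3) = 0"
      using wedge_identity[OF keller _ F(1) _ idx, of "\<zeta> s" 0 0] elim(3) by (simp split: if_splits)
    then show False using elim \<open>eval2 S (\<zeta> s) \<noteq> 0\<close> by simp
  qed
  then show False by simp
qed

text \<open>Since \<open>h\<close> is a unit times \<open>G ^ e\<close>, its differential contains
  the factor \<open>G ^ (e - 1)\<close>, and the remaining cofactor of \<open>dF_i\<close> wedge
  \<open>dh\<close> is nonzero at \<open>z0\<close>. Comparison with the order \<open>k\<close> of
  the other side of the wedge identity, after clearing \<open>S ^ 3\<close>, gives the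
  equation.\<close>

lemma ramification_exponent:
  assumes h: "subst_fract v (extend_map S T f $ 1) (extend_map S T f $ 2) = Fract A B * to_fract G ^ e"
    and AB: "eval2 A z0 \<noteq> 0" "eval2 B z0 \<noteq> 0" and G0: "eval2 G z0 = 0"
    and wedge: "quot_grad1 (P i) (Q i) z0 * eval2 (D2 G) z0 - quot_grad2 (P i) (Q i) z0 * eval2 (D1 G) z0 \<noteq> 0"
    and S: "S * B' = A' * G ^ m" "eval2 A' z0 \<noteq> 0" "eval2 B' z0 \<noteq> 0"
    and pos: "m \<ge> 1" "e \<ge> 1"
  shows "k = 3 * m + (e - 1)"
proof -
  define \<sigma> :: complex where "\<sigma> = (if i = 1 then -1 else 1)"
  \<comment> \<open>The cofactor of \<open>G ^ (e - 1)\<close> in \<open>dF_i\<close> wedge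
    \<open>dh\<close>. On the zero set of \<open>G\<close> only the first summand, a multiple of
    \<open>dF_i\<close> wedge \<open>dG\<close>, survives.\<close>
  define br where "br z = of_nat e * (eval2 A z / eval2 B z) *
       (quot_grad1 (P i) (Q i) z * eval2 (D2 G) z - quot_grad2 (P i) (Q i) z * eval2 (D1 G) z)
     + eval2 G z * (quot_grad1 (P i) (Q i) z * quot_grad2 A B z - quot_grad2 (P i) (Q i) z * quot_grad1 A B z)" for z
  have grad: "has_grad (\<lambda>z. eval2 v (\<Phi> z))
      (quot_grad1 A B z * eval2 G z ^ e + eval2 A z / eval2 B z * (of_nat e * eval2 G z ^ (e - 1) * eval2 (D1 G) z))
      (quot_grad2 A B z * eval2 G z ^ e + eval2 A z / eval2 B z * (of_nat e * eval2 G z ^ (e - 1) * eval2 (D2 G) z)) z"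
    if z: "eval2 B z \<noteq> 0" "\<And>i. eval2 (Q i) z \<noteq> 0" for z
  proof (rule has_grad_transform)
    let ?X = "{z. eval2 B z \<noteq> 0} \<inter> {z. eval2 (Q 1) z \<noteq> 0} \<inter> {z. eval2 (Q 2) z \<noteq> 0}"
    show "has_grad (\<lambda>z. eval2 A z / eval2 B z * eval2 G z ^ e)
      (quot_grad1 A B z * eval2 G z ^ e + eval2 A z / eval2 B z * (of_nat e * eval2 G z ^ (e - 1) * eval2 (D1 G) z))
      (quot_grad2 A B z * eval2 G z ^ e + eval2 A z / eval2 B z * (of_nat e * eval2 G z ^ (e - 1) * eval2 (D2 G) z)) z"
      using z(1) by (intro has_grad_mult has_grad_quot has_grad_power has_grad_eval2)
    show "open ?X" by (intro open_Int open_eval2_nonzero)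
    show "z \<in> ?X" using z by simp
    fix w assume w: "w \<in> ?X"
    have "eval2 (Q j) w \<noteq> 0" for j using w exhaust_2[of j] by auto
    from has_value_pullback_poly[OF F(1) this, of v]
    have "has_value (Fract A B * to_fract G ^ e) w (eval2 v (\<Phi> w))" by (simp only: h)
    moreover have "has_value (Fract A B * to_fract G ^ e) w (eval2 A w / eval2 B w * eval2 G w ^ e)"
      using w by (intro has_value_mult has_value_Fract has_value_power has_value_to_fract) simp
    ultimately show "eval2 A w / eval2 B w * eval2 G w ^ e = eval2 v (\<Phi> w)"
      using has_value_unique by blast
  qed
  have identity: "\<sigma> * eval2 q (\<Phi> z) * eval2 (jac_poly S T) z = eval2 S z ^ 3 * eval2 G z ^ (e - 1) * br z"
    if z: "eval2 S z \<noteq> 0" "eval2 B z \<noteq> 0" "\<And>i. eval2 (Q i) z \<noteq> 0" for z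
  proof -
    have "\<sigma> * eval2 q (\<Phi> z) * (eval2 (jac_poly S T) z / eval2 S z ^ 3) = eval2 G z ^ (e - 1) * br z"
    proof -
      have ring: "a * (r2 * (x * y) + r * (n * y * g2)) - b * (r1 * (x * y) + r * (n * y * g1))
          = y * (n * r * (a * g2 - b * g1) + x * (a * r2 - b * r1))"
        for a b r r1 r2 x y n g1 g2 :: complex by algebra
      have "eval2 G z ^ e = eval2 G z * eval2 G z ^ (e - 1)" using pos(2) by (simp flip: power_Suc)
      then show ?thesis
        using wedge_identity[OF keller z(1) F(1) z(3) idx grad[OF z(2,3)]]
        by (simp only: \<sigma>_def br_def ring)
    qed
    then show ?thesis using z(1) by (simp add: field_simps)
  qed
  \<comment> \<open>\<open>X ^ m\<close> and \<open>Y\<close> collect the factors with nonzero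
    limit. In the \<open>m\<close>-th power of the identity, \<open>G\<close> occurs as
    \<open>(G ^ m) ^ (e - 1)\<close>, which \<open>S * B' = A' * G ^ m\<close> turns into a power of
    \<open>s\<close> times a power of \<open>B' / A'\<close>.\<close>
  define X where "X s = \<sigma> * eval2 q (\<Phi> (\<zeta> s)) * (eval2 (jac_poly S T) (\<zeta> s) / s ^ k)" for s
  define Y where "Y s = (eval2 B' (\<zeta> s) / eval2 A' (\<zeta> s)) ^ (e - 1) * br (\<zeta> s) ^ m" for s
  have "(X \<longlongrightarrow> \<sigma> * eval2 q (\<Phi> z0) * c) (at 0)"
    unfolding X_def by (intro tendsto_intros tendsto_curve_image J)
  then have X: "((\<lambda>s. X s ^ m) \<longlongrightarrow> (\<sigma> * eval2 q (\<Phi> z0) * c) ^ m) (at 0)"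
    by (intro tendsto_intros)
  have Y: "(Y \<longlongrightarrow> (eval2 B' z0 / eval2 A' z0) ^ (e - 1) * br z0 ^ m) (at 0)"
    unfolding Y_def br_def
    by (intro tendsto_intros tendsto_eval2 tendsto_quot_grad \<zeta> F AB S)
  have "br z0 \<noteq> 0" using wedge AB pos by (simp add: br_def G0)
  have "\<forall>\<^sub>F s in at 0. s ^ (k * m) * X s ^ m = s ^ (3 * m * m + m * (e - 1)) * Y s"
    using eventually_curve_denominators eventually_curve_nonzero[OF AB(2)] eventually_curve_nonzero[OF S(2)] \<zeta>(2)
      eventually_neq_at_within[of 0 0 UNIV]
  proof eventually_elim
    case (elim s)
    have S0: "eval2 S (\<zeta> s) \<noteq> 0" using elim(4,5) by simp
    have "s ^ k * X s = \<sigma> * eval2 q (\<Phi> (\<zeta> s)) * eval2 (jac_poly S T) (\<zeta> s)"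
      using elim(5) by (simp add: X_def)
    also have "\<dots> = s ^ (3 * m) * eval2 G (\<zeta> s) ^ (e - 1) * br (\<zeta> s)"
      using identity[OF S0] elim by (simp add: power_mult[symmetric] mult.commute)
    finally have "(s ^ k * X s) ^ m = (s ^ (3 * m) * eval2 G (\<zeta> s) ^ (e - 1) * br (\<zeta> s)) ^ m"
      by simp
    also have "\<dots> = s ^ (3 * m * m) * (eval2 G (\<zeta> s) ^ m) ^ (e - 1) * br (\<zeta> s) ^ m"
      by (simp add: power_mult_distrib mult.commute flip: power_mult)
    also have "eval2 G (\<zeta> s) ^ m = s ^ m * (eval2 B' (\<zeta> s) / eval2 A' (\<zeta> s))"
      using arg_cong[OF S(1), of "\<lambda>A. eval2 A (\<zeta> s)"] elim(3,4) by (simp add: field_simps)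
    finally show ?case
      by (simp add: Y_def power_mult_distrib power_divide power_mult[symmetric] power_add mult_ac)
  qed
  then have "k * m = 3 * m * m + m * (e - 1)"
    using exponents_eq[OF X Y] \<open>br z0 \<noteq> 0\<close> J(2) q S(2,3) by (simp add: \<sigma>_def split: if_splits)
  then have "k * m = (3 * m + (e - 1)) * m" by (simp add: algebra_simps)
  then show ?thesis using pos(1) by (metis mult_cancel2 not_one_le_zero)
qed

end


section \<open>Adapted coordinates\<close>

lemma bounded_linear_matrix:
  "bounded_linear (\<lambda>h. vector [a * fst h + b * snd h, a' * fst h + b' * snd h] :: complex ^ 2)"
proof (intro linear_conv_bounded_linear[THEN iffD1] linearI)
  fix x y :: "complex \<times> complex" and k :: real
  show "vector [a * fst (x + y) + b * snd (x + y), a' * fst (x + y) + b' * snd (x + y)]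
    = vector [a * fst x + b * snd x, a' * fst x + b' * snd x] + (vector [a * fst y + b * snd y, a' * fst y + b' * snd y] :: complex ^ 2)"
    by (simp add: vec2_eq_iff algebra_simps)
  show "vector [a * fst (k *\<^sub>R x) + b * snd (k *\<^sub>R x), a' * fst (k *\<^sub>R x) + b' * snd (k *\<^sub>R x)]
    = k *\<^sub>R (vector [a * fst x + b * snd x, a' * fst x + b' * snd x] :: complex ^ 2)"
    by (simp add: vec2_eq_iff scaleR_add_right)
qed

lemma inverse_matrix:
  fixes a b a' b' d x y :: complex
  assumes "a * b' - b * a' = d" "d \<noteq> 0"
  shows "b' / d * (a * x + b * y) + - b / d * (a' * x + b' * y) = x"
    and "- a' / d * (a * x + b * y) + a / d * (a' * x + b' * y) = y"
proof -
  have 1: "b' * (a * x + b * y) + - b * (a' * x + b' * y) = x * d"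
    and 2: "- a' * (a * x + b * y) + a * (a' * x + b' * y) = y * d"
    unfolding assms(1)[symmetric] by (simp_all add: algebra_simps)
  show "b' / d * (a * x + b * y) + - b / d * (a' * x + b' * y) = x"
    unfolding times_divide_eq_left add_divide_distrib[symmetric] 1 using assms(2) by simp
  show "- a' / d * (a * x + b * y) + a / d * (a' * x + b' * y) = y"
    unfolding times_divide_eq_left add_divide_distrib[symmetric] 2 using assms(2) by simp
qed

text \<open>The coordinates are given as a bijection with an invertible derivative at each point,
  without continuity of the inverse. Invariance of domain supplies that continuity, after which the
  derivative of the inverse is the inverse matrix.\<close>

lemma adapted_inverse:
  assumes "adapted_coordinates \<Gamma> U s t D"
  obtains r \<rho> c \<Phi> and a b' b a' :: "complex \<times> complex \<Rightarrow> complex" where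
    "r > 0" "\<rho> > 0" "D = ball c \<rho>"
    "\<forall>p\<in>ball 0 r \<times> D. \<Phi> p \<in> U \<and> s (\<Phi> p) = fst p \<and> t (\<Phi> p) = snd p"
    "continuous_on (ball 0 r \<times> D) \<Phi>"
    "\<forall>p\<in>ball 0 r \<times> D. a p * b' p - b p * a' p \<noteq> 0"
    "\<forall>p\<in>ball 0 r \<times> D.
      (\<Phi> has_derivative (\<lambda>h. vector [a p * fst h + b p * snd h, a' p * fst h + b' p * snd h])) (at p)"
proof -
  define \<Psi> where "\<Psi> z = (s z, t z)" for z
  obtain r c \<rho> where D: "r > 0" "\<rho> > 0" "D = ball c \<rho>" and bij: "bij_betw \<Psi> U (ball 0 r \<times> D)"
    and U: "open U"
    using assms unfolding adapted_coordinates_def \<Psi>_def by blast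
  define P where "P z a b c d \<longleftrightarrow> (s has_derivative (\<lambda>h. a * h $ 1 + b * h $ 2)) (at z) \<and>
      (t has_derivative (\<lambda>h. c * h $ 1 + d * h $ 2)) (at z) \<and> a * d - b * c \<noteq> 0" for z and a b c d :: complex
  have "\<forall>z\<in>U. \<exists>a b c d. P z a b c d"
    using assms unfolding adapted_coordinates_def P_def by blast
  then obtain A B A' B' where P: "\<And>z. z \<in> U \<Longrightarrow> P z (A z) (B z) (A' z) (B' z)"
    by metis
  have s: "(s has_derivative (\<lambda>h. A z * h $ 1 + B z * h $ 2)) (at z)"
    and t: "(t has_derivative (\<lambda>h. A' z * h $ 1 + B' z * h $ 2)) (at z)"
    and det: "A z * B' z - B z * A' z \<noteq> 0" if "z \<in> U" for z
    using P[OF that] by (simp_all add: P_def)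
  have \<Psi>: "(\<Psi> has_derivative (\<lambda>h. (A z * h $ 1 + B z * h $ 2, A' z * h $ 1 + B' z * h $ 2))) (at z)"
    if "z \<in> U" for z
    unfolding \<Psi>_def using s[OF that] t[OF that] by (rule has_derivative_Pair)
  have cont: "continuous_on U \<Psi>"
    using \<Psi> has_derivative_continuous continuous_at_imp_continuous_on by blast
  have inj: "inj_on \<Psi> U" and im: "\<Psi> ` U = ball 0 r \<times> D" using bij by (auto simp: bij_betw_def)
  have "DIM(complex \<times> complex) \<le> DIM(complex ^ 2)" by simp
  then obtain \<Phi> where hom: "homeomorphism U (ball 0 r \<times> D) \<Psi> \<Phi>"
    using invariance_of_domain_homeomorphism[OF U cont _ inj] im by metis
  define d where "d z = A z * B' z - B z * A' z" for z
  have \<Phi>: "\<Phi> p \<in> U" "\<Psi> (\<Phi> p) = p" if "p \<in> ball 0 r \<times> D" for p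
    using hom that by (auto simp: homeomorphism_def)
  have cont\<Phi>: "continuous_on (ball 0 r \<times> D) \<Phi>" using hom by (simp add: homeomorphism_def)
  have op: "open (ball (0 :: complex) r \<times> D)" by (simp add: D open_Times)
  have deriv: "(\<Phi> has_derivative (\<lambda>h. vector
      [B' (\<Phi> p) / d (\<Phi> p) * fst h + - B (\<Phi> p) / d (\<Phi> p) * snd h,
       - A' (\<Phi> p) / d (\<Phi> p) * fst h + A (\<Phi> p) / d (\<Phi> p) * snd h])) (at p)"
    (is "(_ has_derivative ?g) _") if p: "p \<in> ball 0 r \<times> D" for p
  proof (rule has_derivative_inverse_basic[where f = \<Psi> and T = "ball 0 r \<times> D"])
    show "(\<Psi> has_derivative (\<lambda>h. (A (\<Phi> p) * h $ 1 + B (\<Phi> p) * h $ 2, A' (\<Phi> p) * h $ 1 + B' (\<Phi> p) * h $ 2))) (at (\<Phi> p))"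
      using \<Psi> \<Phi> p by blast
    show "bounded_linear ?g" by (rule bounded_linear_matrix)
    have "d (\<Phi> p) \<noteq> 0" using det \<Phi> p by (simp add: d_def)
    then show "?g \<circ> (\<lambda>h. (A (\<Phi> p) * h $ 1 + B (\<Phi> p) * h $ 2, A' (\<Phi> p) * h $ 1 + B' (\<Phi> p) * h $ 2)) = id"
      using inverse_matrix[OF d_def[symmetric, of "\<Phi> p"]]
      unfolding fun_eq_iff vec2_eq_iff comp_def fst_conv snd_conv vector_2 id_apply by blast
    show "continuous (at p) \<Phi>"
      using cont\<Phi> p continuous_on_eq_continuous_at[OF op] by blast
    show "open (ball (0 :: complex) r \<times> D)" by (fact op)
    show "p \<in> ball 0 r \<times> D" by (fact p)
    show "\<Psi> (\<Phi> z) = z" if "z \<in> ball 0 r \<times> D" for z using \<Phi> that by blast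
  qed
  show thesis
  proof (rule that[OF D, of \<Phi> "\<lambda>p. B' (\<Phi> p) / d (\<Phi> p)" "\<lambda>p. A (\<Phi> p) / d (\<Phi> p)"
        "\<lambda>p. - B (\<Phi> p) / d (\<Phi> p)" "\<lambda>p. - A' (\<Phi> p) / d (\<Phi> p)"]; (intro ballI)?)
    fix p :: "complex \<times> complex" assume p: "p \<in> ball 0 r \<times> D"
    have "(s (\<Phi> p), t (\<Phi> p)) = p" using \<Phi>(2)[OF p] by (simp add: \<Psi>_def)
    from arg_cong[OF this, of fst] arg_cong[OF this, of snd]
    show "\<Phi> p \<in> U \<and> s (\<Phi> p) = fst p \<and> t (\<Phi> p) = snd p" using \<Phi>(1)[OF p] by simp
    have "B' (\<Phi> p) / d (\<Phi> p) * (A (\<Phi> p) / d (\<Phi> p)) - - B (\<Phi> p) / d (\<Phi> p) * (- A' (\<Phi> p) / d (\<Phi> p))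
      = d (\<Phi> p) / (d (\<Phi> p) * d (\<Phi> p))"
      by (simp add: d_def diff_divide_distrib mult.commute)
    then show "B' (\<Phi> p) / d (\<Phi> p) * (A (\<Phi> p) / d (\<Phi> p)) - - B (\<Phi> p) / d (\<Phi> p) * (- A' (\<Phi> p) / d (\<Phi> p)) \<noteq> 0"
      using det \<Phi> p by (simp add: d_def)
  qed (use cont\<Phi> deriv in auto)
qed

text \<open>Weierstrass' theorem: derivatives of a uniform limit of holomorphic functions converge.
  The derivative of \<open>g\<close> serves to identify the limit.\<close>

lemma derivative_limit:
  fixes h :: "complex \<Rightarrow> complex \<Rightarrow> complex"
  assumes lim: "uniform_limit (cball t0 \<delta>) h g (at 0)" and \<delta>: "\<delta> > 0"
    and deriv: "\<forall>\<^sub>F s in at (0 :: complex). \<forall>t\<in>cball t0 \<delta>. (h s has_field_derivative h' s t) (at t)"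
    and g: "(g has_field_derivative d) (at t0)"
  shows "((\<lambda>s. h' s t0) \<longlongrightarrow> d) (at 0)"
proof -
  have *: "\<forall>\<^sub>F s in at 0. continuous_on (cball t0 \<delta>) (h s) \<and>
      (\<forall>t\<in>ball t0 \<delta>. (h s has_field_derivative h' s t) (at t))"
    using deriv
  proof eventually_elim
    case (elim s)
    then have "continuous_on (cball t0 \<delta>) (h s)"
      by (meson DERIV_isCont continuous_at_imp_continuous_on)
    with elim show ?case by auto
  qed
  obtain g' where "\<And>w. w \<in> ball t0 \<delta> \<Longrightarrow>
      (g has_field_derivative g' w) (at w) \<and> ((\<lambda>s. h' s w) \<longlongrightarrow> g' w) (at 0)"
    by (rule has_complex_derivative_uniform_limit[where f = h and f' = h' and F = "at 0", OF * lim])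
      (use \<delta> in auto)
  from this[of t0] show ?thesis using \<delta> g DERIV_unique by auto
qed

text \<open>Uniform continuity on a compact product; the radius \<open>r / 2\<close> makes the first
  factor compact inside the disc.\<close>

lemma uniform_limit_slices:
  fixes h :: "complex \<times> complex \<Rightarrow> complex"
  assumes cont: "continuous_on (ball 0 r \<times> X) h" and "r > 0" and K: "compact K" "K \<subseteq> X"
  shows "uniform_limit K (\<lambda>s t. h (s, t)) (\<lambda>t. h (0, t)) (at 0)"
proof (rule uniform_limitI)
  fix e :: real assume e: "e > 0"
  have "cball (0 :: complex) (r / 2) \<subseteq> ball 0 r" using \<open>r > 0\<close> by auto
  then have "continuous_on (cball 0 (r / 2) \<times> K) h"
    using cont K(2) by (auto intro: continuous_on_subset)
  moreover have "compact (cball (0 :: complex) (r / 2) \<times> K)" using K(1) by (intro compact_Times) auto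
  ultimately have "uniformly_continuous_on (cball 0 (r / 2) \<times> K) h"
    by (rule compact_uniformly_continuous)
  then obtain \<delta> where \<delta>: "\<delta> > 0" and
    *: "\<And>p q. p \<in> cball 0 (r / 2) \<times> K \<Longrightarrow> q \<in> cball 0 (r / 2) \<times> K \<Longrightarrow> dist q p < \<delta> \<Longrightarrow> dist (h q) (h p) < e"
    using e unfolding uniformly_continuous_on_def by metis
  have "\<forall>\<^sub>F s in at (0 :: complex). dist s 0 < min \<delta> (r / 2)"
    using \<delta> \<open>r > 0\<close> by (simp add: eventually_at) (intro exI[of _ "min \<delta> (r / 2)"], simp)
  then show "\<forall>\<^sub>F s in at 0. \<forall>t\<in>K. dist (h (s, t)) (h (0, t)) < e"
  proof eventually_elim
    case (elim s)
    show ?case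
    proof
      fix t assume "t \<in> K"
      show "dist (h (s, t)) (h (0, t)) < e"
      proof (rule *)
        have "dist (s, t) (0, t) = norm s" by (simp add: dist_Pair_Pair)
        then show "dist (s, t) (0, t) < \<delta>" using elim by simp
      qed (use elim \<open>t \<in> K\<close> \<open>r > 0\<close> in auto)
    qed
  qed
qed

text \<open>\<open>a i\<close> is the Taylor coefficient of the sum, so Cauchy's inequality on the
  circle of radius \<open>\<rho>\<close> applies.\<close>

lemma power_series_coeff_bound:
  fixes a :: "nat \<Rightarrow> complex"
  assumes sums: "\<And>s. norm s < r \<Longrightarrow> (\<lambda>i. a i * s ^ i) sums f s"
    and \<rho>: "0 < \<rho>" "\<rho> < r" and M: "\<And>s. norm s = \<rho> \<Longrightarrow> norm (f s) \<le> M"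
  shows "norm (a i) \<le> M / \<rho> ^ i"
proof -
  have "f has_fps_expansion Abs_fps a"
    unfolding has_fps_expansion_def
  proof
    have "conv_radius a \<ge> norm (of_real \<rho> :: complex)"
      using sums[of "of_real \<rho>"] \<rho> by (intro conv_radius_geI) (auto simp: sums_iff)
    then have "conv_radius a \<ge> ereal \<rho>" using \<rho>(1) by simp
    then show "fps_conv_radius (Abs_fps a) > 0"
      using \<rho>(1) unfolding fps_conv_radius_def by (simp add: less_le_trans[of 0 "ereal \<rho>"])
    have "\<forall>\<^sub>F s in nhds (0 :: complex). s \<in> ball 0 r"
      using \<rho> by (intro eventually_nhds_in_open) auto
    then show "\<forall>\<^sub>F s in nhds 0. eval_fps (Abs_fps a) s = f s"
      by eventually_elim (use sums in \<open>auto simp: eval_fps_def sums_iff\<close>)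
  qed
  from fps_nth_fps_expansion[OF this, of i] have a: "a i = (deriv ^^ i) f 0 / fact i" by simp
  have hol: "f holomorphic_on ball 0 r"
    using sums by (intro power_series_holomorphic[of 0 r a]) auto
  have "norm ((deriv ^^ i) f 0) \<le> fact i * M / \<rho> ^ i"
  proof (rule Cauchy_inequality)
    show "f holomorphic_on ball 0 \<rho>" using hol \<rho> by (auto intro: holomorphic_on_subset)
    have "cball (0 :: complex) \<rho> \<subseteq> ball 0 r" using \<rho> by auto
    then show "continuous_on (cball 0 \<rho>) f"
      using hol holomorphic_on_imp_continuous_on continuous_on_subset by blast
  qed (use \<rho> M in auto)
  then show ?thesis by (simp add: a norm_divide field_simps)
qed

text \<open>The coefficients of the power series are bounded by Cauchy's inequality, uniformly near \<open>t0\<close>.\<close>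

lemma uniform_limit_leading_coefficient:
  fixes \<beta> :: "nat \<Rightarrow> complex \<Rightarrow> complex"
  assumes cont: "continuous_on (ball 0 r \<times> D) \<tau>" and r: "r > 0"
    and sums: "\<And>s t. norm s < r \<Longrightarrow> t \<in> D \<Longrightarrow> (\<lambda>i. \<beta> i t * s ^ i) sums \<tau> (s, t)"
    and K: "compact K" "K \<subseteq> D"
  shows "uniform_limit K (\<lambda>s t. (\<tau> (s, t) - (\<Sum>i<N. \<beta> i t * s ^ i)) / s ^ N) (\<beta> N) (at 0)"
proof -
  define \<rho> where "\<rho> = r / 2"
  have \<rho>: "0 < \<rho>" "\<rho> < r" using r by (auto simp: \<rho>_def)
  have sub: "cball 0 \<rho> \<times> K \<subseteq> ball 0 r \<times> D" using K(2) \<rho> by auto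
  have "compact (\<tau> ` (cball 0 \<rho> \<times> K))"
    using continuous_on_subset[OF cont sub] K(1) by (intro compact_continuous_image compact_Times) auto
  then obtain M where M: "M > 0" "\<And>p. p \<in> cball 0 \<rho> \<times> K \<Longrightarrow> norm (\<tau> p) \<le> M"
    using compact_imp_bounded bounded_pos by (metis imageI)
  have \<beta>: "norm (\<beta> i t) \<le> M / \<rho> ^ i" if "t \<in> K" for i t
    using that K(2) by (intro power_series_coeff_bound[OF sums \<rho>] M) auto
  \<comment> \<open>The remainder after the term of index \<open>N\<close> is dominated by a
    geometric series of ratio \<open>x = norm s / \<rho>\<close>. As \<open>x\<close> is at most
    1/2, its sum is at most twice its first term, whence the factor 2.\<close>
  have bound: "norm ((\<tau> (s, t) - (\<Sum>i<N. \<beta> i t * s ^ i)) / s ^ N - \<beta> N t) \<le> 2 * M / \<rho> ^ Suc N * norm s"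
    if s: "s \<noteq> 0" "norm s < \<rho> / 2" and t: "t \<in> K" for s t
  proof -
    define x where "x = norm s / \<rho>"
    have x: "0 \<le> x" "x \<le> 1 / 2" using s(2) \<rho>(1) by (auto simp: x_def field_simps)
    have "norm s < r" using s \<rho> by linarith
    then have "(\<lambda>i. \<beta> (i + Suc N) t * s ^ (i + Suc N)) sums (\<tau> (s, t) - (\<Sum>i<Suc N. \<beta> i t * s ^ i))"
      using sums t K(2) by (intro sums_split_initial_segment) auto
    then have eq: "\<tau> (s, t) - (\<Sum>i<Suc N. \<beta> i t * s ^ i) = (\<Sum>i. \<beta> (i + Suc N) t * s ^ (i + Suc N))"
      by (simp add: sums_iff)
    have le: "norm (\<beta> (i + Suc N) t * s ^ (i + Suc N)) \<le> M * x ^ Suc N * x ^ i" for i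
    proof -
      have "norm (\<beta> (i + Suc N) t * s ^ (i + Suc N)) \<le> M / \<rho> ^ (i + Suc N) * norm s ^ (i + Suc N)"
        unfolding norm_mult norm_power by (intro mult_right_mono \<beta>[OF t]) auto
      also have "\<dots> = M * x ^ (i + Suc N)" by (simp add: x_def power_divide)
      finally show ?thesis by (simp add: power_add mult_ac)
    qed
    have geo: "summable (\<lambda>i. M * x ^ Suc N * x ^ i)" using x by (intro summable_mult summable_geometric) auto
    have "norm (\<tau> (s, t) - (\<Sum>i<Suc N. \<beta> i t * s ^ i)) \<le> (\<Sum>i. M * x ^ Suc N * x ^ i)"
      unfolding eq by (rule norm_suminf_le[OF le geo])
    also have "\<dots> = M * x ^ Suc N * (1 / (1 - x))"
      using x by (subst suminf_mult) (auto simp: suminf_geometric summable_geometric)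
    also have "\<dots> \<le> M * x ^ Suc N * 2"
      using x M(1) by (intro mult_left_mono) (auto simp: field_simps)
    finally have *: "norm (\<tau> (s, t) - (\<Sum>i<Suc N. \<beta> i t * s ^ i)) \<le> 2 * M * x ^ Suc N" by simp
    have "(\<tau> (s, t) - (\<Sum>i<N. \<beta> i t * s ^ i)) / s ^ N - \<beta> N t = (\<tau> (s, t) - (\<Sum>i<Suc N. \<beta> i t * s ^ i)) / s ^ N"
      using s(1) by (simp add: field_simps)
    then have "norm ((\<tau> (s, t) - (\<Sum>i<N. \<beta> i t * s ^ i)) / s ^ N - \<beta> N t)
        = norm (\<tau> (s, t) - (\<Sum>i<Suc N. \<beta> i t * s ^ i)) / norm s ^ N"
      by (simp only: norm_divide norm_power)
    also have "\<dots> \<le> 2 * M * x ^ Suc N / norm s ^ N" using * by (rule divide_right_mono) simp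
    also have "\<dots> = 2 * M / \<rho> ^ Suc N * norm s" using s(1) by (simp add: x_def power_divide)
    finally show ?thesis .
  qed
  show ?thesis
  proof (rule uniform_limitI)
    fix e :: real assume e: "e > 0"
    have "((\<lambda>s :: complex. 2 * M / \<rho> ^ Suc N * norm s) \<longlongrightarrow> 2 * M / \<rho> ^ Suc N * norm (0 :: complex)) (at 0)"
      by (intro tendsto_intros)
    then have "\<forall>\<^sub>F s in at (0 :: complex). 2 * M / \<rho> ^ Suc N * norm s < e"
      using e by (intro order_tendstoD) auto
    moreover have "\<forall>\<^sub>F s in at (0 :: complex). norm s < \<rho> / 2"
      using \<rho> by (simp add: eventually_at) (intro exI[of _ "\<rho> / 2"], simp)
    ultimately show "\<forall>\<^sub>F s in at 0. \<forall>t\<in>K. dist ((\<tau> (s, t) - (\<Sum>i<N. \<beta> i t * s ^ i)) / s ^ N) (\<beta> N t) < e"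
      using eventually_neq_at_within[of 0 0 UNIV]
    proof eventually_elim
      case (elim s)
      show ?case
        unfolding dist_norm using bound[OF elim(3,2)] elim(1) by (blast intro: le_less_trans)
    qed
  qed
qed

section \<open>Differentiation in adapted coordinates\<close>

lemma has_field_derivative_eval2:
  assumes "((\<lambda>x. \<phi> x $ 1) has_field_derivative p) (at x)" "((\<lambda>x. \<phi> x $ 2) has_field_derivative q) (at x)"
  shows "((\<lambda>x. eval2 A (\<phi> x)) has_field_derivative
    eval2 (D1 A) (\<phi> x) * p + eval2 (D2 A) (\<phi> x) * q) (at x)"
proof (induction A)
  case 0
  then show ?case by simp
next
  case (pCons c A)
  have "((\<lambda>x. poly c (\<phi> x $ 1) + \<phi> x $ 2 * eval2 A (\<phi> x)) has_field_derivative
    p * poly (pderiv c) (\<phi> x $ 1) + (q * eval2 A (\<phi> x)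
      + (eval2 (D1 A) (\<phi> x) * p + eval2 (D2 A) (\<phi> x) * q) * \<phi> x $ 2)) (at x)"
    by (intro DERIV_add DERIV_mult has_field_derivative_poly assms pCons.IH)
  then show ?case by (simp add: eval2_pCons D1_pCons pderiv_pCons algebra_simps)
qed

lemma partial_derivatives:
  fixes \<Phi> :: "complex \<times> complex \<Rightarrow> complex ^ 2"
  assumes "(\<Phi> has_derivative (\<lambda>h. vector [a * fst h + b * snd h, a' * fst h + b' * snd h])) (at (s, t))"
  shows "((\<lambda>s. \<Phi> (s, t) $ 1) has_field_derivative a) (at s)"
    and "((\<lambda>s. \<Phi> (s, t) $ 2) has_field_derivative a') (at s)"
    and "((\<lambda>t. \<Phi> (s, t) $ 1) has_field_derivative b) (at t)"
    and "((\<lambda>t. \<Phi> (s, t) $ 2) has_field_derivative b') (at t)"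
proof -
  have "((\<lambda>s. (s, t)) has_derivative (\<lambda>h. (h, 0))) (at s)" "((\<lambda>t. (s, t)) has_derivative (\<lambda>h. (0, h))) (at t)"
    by (auto intro!: derivative_eq_intros)
  from has_derivative_compose[OF this(1) assms] has_derivative_compose[OF this(2) assms]
  have 1: "((\<lambda>s. \<Phi> (s, t)) has_derivative (\<lambda>h. vector [a * h, a' * h])) (at s)"
    and 2: "((\<lambda>t. \<Phi> (s, t)) has_derivative (\<lambda>h. vector [b * h, b' * h])) (at t)" by simp_all
  show "((\<lambda>s. \<Phi> (s, t) $ 1) has_field_derivative a) (at s)"
    "((\<lambda>s. \<Phi> (s, t) $ 2) has_field_derivative a') (at s)"
    "((\<lambda>t. \<Phi> (s, t) $ 1) has_field_derivative b) (at t)"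
    "((\<lambda>t. \<Phi> (s, t) $ 2) has_field_derivative b') (at t)"
    using bounded_linear.has_derivative[OF bounded_linear_vec_nth 1, of 1]
      bounded_linear.has_derivative[OF bounded_linear_vec_nth 1, of 2]
      bounded_linear.has_derivative[OF bounded_linear_vec_nth 2, of 1]
      bounded_linear.has_derivative[OF bounded_linear_vec_nth 2, of 2]
    by (simp_all add: has_field_derivative_def)
qed

text \<open>The inverse chart restricted to \<open>s = 0\<close>. Its velocity is the second column
  of an invertible matrix, hence nonzero.\<close>

lemma curve_parametrization:
  assumes "adapted_coordinates \<Gamma> U s t D"
  obtains c \<rho> \<phi> p q where "\<rho> > 0" "inj_on \<phi> (ball c \<rho>)" "\<phi> ` ball c \<rho> \<subseteq> \<Gamma>"
    "\<And>x. x \<in> ball c \<rho> \<Longrightarrow> ((\<lambda>x. \<phi> x $ 1) has_field_derivative p x) (at x)"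
    "\<And>x. x \<in> ball c \<rho> \<Longrightarrow> ((\<lambda>x. \<phi> x $ 2) has_field_derivative q x) (at x)"
    "\<And>x. x \<in> ball c \<rho> \<Longrightarrow> p x \<noteq> 0 \<or> q x \<noteq> 0"
proof -
  obtain r c \<rho> \<Phi> a b a' b' where D: "r > 0" "\<rho> > 0" "D = ball c \<rho>"
    and \<Phi>0: "\<forall>p\<in>ball 0 r \<times> D. \<Phi> p \<in> U \<and> s (\<Phi> p) = fst p \<and> t (\<Phi> p) = snd p"
    and "continuous_on (ball 0 r \<times> D) \<Phi>"
    and det0: "\<forall>p\<in>ball 0 r \<times> D. a p * b' p - b p * a' p \<noteq> 0"
    and deriv0: "\<forall>p\<in>ball 0 r \<times> D.
      (\<Phi> has_derivative (\<lambda>h. vector [a p * fst h + b p * snd h, a' p * fst h + b' p * snd h])) (at p)"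
    by (rule adapted_inverse[OF assms])
  note \<Phi> = \<Phi>0[rule_format] and det = det0[rule_format] and deriv = deriv0[rule_format]
  have \<Gamma>: "\<Gamma> \<inter> U = {z\<in>U. s z = 0}" using assms by (simp add: adapted_coordinates_def)
  show thesis
  proof (rule that[of \<rho> "\<lambda>x. \<Phi> (0, x)" c "\<lambda>x. b (0, x)" "\<lambda>x. b' (0, x)"])
    show "\<rho> > 0" by (fact D)
    have mem: "(0 :: complex, x) \<in> ball 0 r \<times> D" if "x \<in> ball c \<rho>" for x using that D by simp
    show "inj_on (\<lambda>x. \<Phi> (0, x)) (ball c \<rho>)"
      using \<Phi> mem by (intro inj_onI) (metis snd_conv)
    show "(\<lambda>x. \<Phi> (0, x)) ` ball c \<rho> \<subseteq> \<Gamma>"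
      using \<Phi> mem \<Gamma> by (metis (mono_tags, lifting) IntE fst_conv image_subsetI mem_Collect_eq)
    fix x assume x: "x \<in> ball c \<rho>"
    show "((\<lambda>x. \<Phi> (0, x) $ 1) has_field_derivative b (0, x)) (at x)"
      "((\<lambda>x. \<Phi> (0, x) $ 2) has_field_derivative b' (0, x)) (at x)" "b (0, x) \<noteq> 0 \<or> b' (0, x) \<noteq> 0"
      using partial_derivatives(3,4)[OF deriv[OF mem[OF x]]] det[OF mem[OF x]] by auto
  qed
qed

text \<open>In the coordinates \<open>(s, t)\<close> the function \<open>S\<close> is
  \<open>s ^ m\<close>, independent of \<open>t\<close>, so \<open>dS\<close> wedge
  \<open>dT\<close> has coefficient \<open>m * s ^ (m - 1)\<close> times the
  \<open>t\<close>-derivative of \<open>T\<close>. The first coefficient with nonzero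
  \<open>t\<close>-derivative is that of \<open>s ^ N\<close>. The set \<open>E\<close> collects
  points that later arguments must avoid.\<close>

lemma jacobian_along_curve:
  assumes adapted: "adapted_coordinates \<Gamma> U s t D"
    and S: "\<And>z. z \<in> U \<Longrightarrow> s z ^ m = eval2 S z"
    and \<beta>: "\<And>i. \<beta> i holomorphic_on D"
    and T: "\<And>z. z \<in> U \<Longrightarrow> (\<lambda>i. \<beta> i (t z) * s z ^ i) sums eval2 T z"
    and const: "\<And>i. i < N \<Longrightarrow> \<beta> i constant_on D"
    and nonconst: "\<not> \<beta> N constant_on D"
    and m: "m \<ge> 1" and E: "finite E"
  obtains z0 \<zeta> c where "z0 \<in> \<Gamma> - E" "(\<zeta> \<longlongrightarrow> z0) (at 0)"
    "\<forall>\<^sub>F s in at 0. eval2 S (\<zeta> s) = s ^ m"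
    "((\<lambda>s. eval2 (jac_poly S T) (\<zeta> s) / s ^ (m - 1 + N)) \<longlongrightarrow> c) (at 0)" "c \<noteq> 0"
proof -
  obtain r c \<rho> \<Phi> a b a' b' where D: "r > 0" "\<rho> > 0" "D = ball c \<rho>"
    and \<Phi>0: "\<forall>p\<in>ball 0 r \<times> D. \<Phi> p \<in> U \<and> s (\<Phi> p) = fst p \<and> t (\<Phi> p) = snd p"
    and cont: "continuous_on (ball 0 r \<times> D) \<Phi>"
    and det0: "\<forall>p\<in>ball 0 r \<times> D. a p * b' p - b p * a' p \<noteq> 0"
    and deriv0: "\<forall>p\<in>ball 0 r \<times> D.
      (\<Phi> has_derivative (\<lambda>h. vector [a p * fst h + b p * snd h, a' p * fst h + b' p * snd h])) (at p)"
    by (rule adapted_inverse[OF adapted])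
  note \<Phi> = \<Phi>0[rule_format] and det = det0[rule_format] and deriv = deriv0[rule_format]
  have opD: "open D" and conD: "connected D" by (simp_all add: D)
  have \<beta>': "(\<beta> N has_field_derivative deriv (\<beta> N) x) (at x)" if "x \<in> D" for x
    using \<beta> opD that holomorphic_derivI by blast
  have mem: "(0 :: complex, x) \<in> ball 0 r \<times> D" if "x \<in> D" for x using that D by simp
  have "inj_on (\<lambda>x. \<Phi> (0, x)) D" using \<Phi> mem by (intro inj_onI) (metis snd_conv)
  then have fin: "finite {x \<in> D. \<Phi> (0, x) \<in> E}"
    using finite_vimage_IntI[OF E, of "\<lambda>x. \<Phi> (0, x)" D] by (simp add: vimage_def Int_def conj_commute)
  \<comment> \<open>The inverse chart is injective on \<open>s = 0\<close>, so \<open>E\<close>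
    excludes finitely many parameters; if the derivative of \<open>\<beta> N\<close> vanished at all
    others, \<open>\<beta> N\<close> would be constant.\<close>
  obtain t0 where t0: "t0 \<in> D" "\<Phi> (0, t0) \<notin> E" "deriv (\<beta> N) t0 \<noteq> 0"
  proof (rule ccontr)
    assume "\<not> thesis"
    then have "\<forall>x\<in>D - {x \<in> D. \<Phi> (0, x) \<in> E}. DERIV (\<beta> N) x :> 0"
      using \<beta>' that by (metis (mono_tags, lifting) DiffE mem_Collect_eq)
    then have "\<beta> N constant_on D"
      using DERIV_zero_connected_constant_on conD opD fin holomorphic_on_imp_continuous_on[OF \<beta>] by blast
    then show False using nonconst by blast
  qed
  obtain \<delta> where \<delta>: "\<delta> > 0" "cball t0 \<delta> \<subseteq> D" using opD t0(1) open_contains_cball by blast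
  have mem': "(s, x) \<in> ball 0 r \<times> D" if "norm s < r" "x \<in> cball t0 \<delta>" for s x
    using that \<delta> by auto
  have near: "\<forall>\<^sub>F s in at (0 :: complex). norm s < r"
    using D(1) by (simp add: eventually_at) (intro exI[of _ r], simp)
  have t0': "t0 \<in> cball t0 \<delta>" using \<delta> by simp
  define z0 where "z0 = \<Phi> (0, t0)"
  define \<zeta> where "\<zeta> s = \<Phi> (s, t0)" for s
  have "\<Gamma> \<inter> U = {z\<in>U. s z = 0}" using adapted by (simp add: adapted_coordinates_def)
  then have "z0 \<in> \<Gamma> - E"
    using \<Phi>[OF mem[OF t0(1)]] t0(2) by (auto simp: z0_def)
  \<comment> \<open>The derivative of the chart is given only pointwise, so convergence of its
    matrix entries as \<open>s\<close> tends to 0 needs proof. The entries \<open>b\<close>,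
    \<open>b'\<close> are \<open>t\<close>-derivatives of slices that converge uniformly.\<close>
  have limit: "((\<lambda>s. d (s, t0)) \<longlongrightarrow> d (0, t0)) (at 0)"
    if h: "continuous_on (ball 0 r \<times> D) h" 
      and d: "\<And>s x. (s, x) \<in> ball 0 r \<times> D \<Longrightarrow> ((\<lambda>x. h (s, x)) has_field_derivative d (s, x)) (at x)"
    for h d :: "complex \<times> complex \<Rightarrow> complex"
  proof (rule derivative_limit[where h = "\<lambda>s x. h (s, x)" and h' = "\<lambda>s x. d (s, x)"])
    show "uniform_limit (cball t0 \<delta>) (\<lambda>s x. h (s, x)) (\<lambda>x. h (0, x)) (at 0)"
      using h D(1) compact_cball \<delta>(2) by (rule uniform_limit_slices)
    show "\<forall>\<^sub>F s in at 0. \<forall>x\<in>cball t0 \<delta>. ((\<lambda>x. h (s, x)) has_field_derivative d (s, x)) (at x)"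
      using near by eventually_elim (use d mem' in blast)
  qed (use \<delta> d mem t0 in blast)+
  note partial = partial_derivatives[OF deriv]
  have comp: "continuous_on (ball 0 r \<times> D) (\<lambda>p. \<Phi> p $ i)" for i
    using cont by (intro continuous_intros)
  have b: "((\<lambda>s. b (s, t0)) \<longlongrightarrow> b (0, t0)) (at 0)" using limit[OF comp partial(3)] .
  have b': "((\<lambda>s. b' (s, t0)) \<longlongrightarrow> b' (0, t0)) (at 0)" using limit[OF comp partial(4)] .
  \<comment> \<open>The entries \<open>a\<close>, \<open>a'\<close> at \<open>t0\<close> are
    derivatives in \<open>s\<close> of holomorphic functions of \<open>s\<close>, hence
    continuous.\<close>
  have limit': "((\<lambda>s. d (s, t0)) \<longlongrightarrow> d (0, t0)) (at 0)"
    if d: "\<And>s. (s, t0) \<in> ball 0 r \<times> D \<Longrightarrow> ((\<lambda>s. h (s, t0)) has_field_derivative d (s, t0)) (at s)"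
    for h d :: "complex \<times> complex \<Rightarrow> complex"
  proof -
    have d': "((\<lambda>s. h (s, t0)) has_field_derivative d (s, t0)) (at s)" if "s \<in> ball 0 r" for s
      using d that t0 by simp
    have "(\<lambda>s. h (s, t0)) holomorphic_on ball 0 r"
      unfolding holomorphic_on_open[OF open_ball] using d' by blast
    then have "(\<lambda>s. deriv (\<lambda>s. h (s, t0)) s) holomorphic_on ball 0 r"
      by (rule holomorphic_deriv) simp
    then have "(\<lambda>s. d (s, t0)) holomorphic_on ball 0 r"
      by (rule holomorphic_transform) (use d' DERIV_imp_deriv in blast)
    then have "isCont (\<lambda>s. d (s, t0)) 0"
      using D(1) holomorphic_on_imp_continuous_on continuous_on_eq_continuous_at[OF open_ball] by (metis centre_in_ball)
    then show ?thesis by (simp add: isCont_def)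
  qed
  have a: "((\<lambda>s. a (s, t0)) \<longlongrightarrow> a (0, t0)) (at 0)" using limit'[OF partial(1)] .
  have a': "((\<lambda>s. a' (s, t0)) \<longlongrightarrow> a' (0, t0)) (at 0)" using limit'[OF partial(2)] .
  define \<tau> where "\<tau> p = eval2 T (\<Phi> p)" for p
  define \<tau>' where "\<tau>' p = eval2 (D1 T) (\<Phi> p) * b p + eval2 (D2 T) (\<Phi> p) * b' p" for p
  have \<tau>': "((\<lambda>x. \<tau> (s, x)) has_field_derivative \<tau>' (s, x)) (at x)" if "(s, x) \<in> ball 0 r \<times> D" for s x
    unfolding \<tau>_def \<tau>'_def by (rule has_field_derivative_eval2[OF partial(3,4)[OF that]])
  have cont\<tau>: "continuous_on (ball 0 r \<times> D) \<tau>"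
    unfolding \<tau>_def using cont continuous_on_compose2[OF continuous_on_eval2] by blast
  have sums: "(\<lambda>i. \<beta> i x * s ^ i) sums \<tau> (s, x)" if "norm s < r" "x \<in> D" for s x
    using T[of "\<Phi> (s, x)"] \<Phi>[of "(s, x)"] that by (simp add: \<tau>_def)
  \<comment> \<open>The terms of index below \<open>N\<close> do not depend on \<open>t\<close>.
    Subtracting them leaves the \<open>t\<close>-derivative \<open>\<tau>'\<close> unchanged but
    makes division by \<open>s ^ N\<close> converge uniformly.\<close>
  have lim\<tau>: "((\<lambda>s. \<tau>' (s, t0) / s ^ N) \<longlongrightarrow> deriv (\<beta> N) t0) (at 0)"
  proof (rule derivative_limit[where h' = "\<lambda>s x. \<tau>' (s, x) / s ^ N"])
    show "uniform_limit (cball t0 \<delta>) (\<lambda>s x. (\<tau> (s, x) - (\<Sum>i<N. \<beta> i x * s ^ i)) / s ^ N) (\<beta> N) (at 0)"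
      using cont\<tau> D(1) sums compact_cball \<delta>(2) by (rule uniform_limit_leading_coefficient)
    show "\<forall>\<^sub>F s in at 0. \<forall>x\<in>cball t0 \<delta>.
      ((\<lambda>x. (\<tau> (s, x) - (\<Sum>i<N. \<beta> i x * s ^ i)) / s ^ N) has_field_derivative \<tau>' (s, x) / s ^ N) (at x)"
      using near
    proof eventually_elim
      case (elim s)
      show ?case
      proof
        fix x assume x: "x \<in> cball t0 \<delta>"
        then have xD: "x \<in> D" using \<delta> by blast
        have "(\<beta> i has_field_derivative 0) (at x)" if i: "i < N" for i
        proof -
          obtain k where "\<And>y. y \<in> D \<Longrightarrow> \<beta> i y = k" using const[OF i] by (auto simp: constant_on_def)
          then show ?thesis
            using has_field_derivative_transform_within_open[OF DERIV_const[of k] opD xD] by metis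
        qed
        then have "((\<lambda>x. \<Sum>i<N. \<beta> i x * s ^ i) has_field_derivative (\<Sum>i<N. 0 * s ^ i)) (at x)"
          by (intro DERIV_sum DERIV_cmult_right) auto
        from DERIV_cdivide[OF DERIV_diff[OF \<tau>'[OF mem'[OF elim x]] this]]
        show "((\<lambda>x. (\<tau> (s, x) - (\<Sum>i<N. \<beta> i x * s ^ i)) / s ^ N) has_field_derivative \<tau>' (s, x) / s ^ N) (at x)"
          by simp
      qed
    qed
  qed (use \<delta> \<beta>' t0 in auto)
  define d where "d s = a (s, t0) * b' (s, t0) - b (s, t0) * a' (s, t0)" for s
  have d: "(d \<longlongrightarrow> d 0) (at 0)" unfolding d_def by (intro tendsto_intros a b a' b')
  have d0: "d s \<noteq> 0" if "norm s < r" for s unfolding d_def using det mem'[OF that t0'] by blast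
  have S\<Phi>: "eval2 S (\<Phi> p) = fst p ^ m" if "p \<in> ball 0 r \<times> D" for p
    using S \<Phi>[OF that] by metis
  \<comment> \<open>Multiplicativity of determinants: \<open>d s\<close> is the Jacobian of the
    inverse chart, and the product is the Jacobian of \<open>S\<close> and \<open>T\<close> in the
    coordinates \<open>(s, t)\<close>.\<close>
  have J: "eval2 (jac_poly S T) (\<zeta> s) * d s = of_nat m * s ^ (m - 1) * \<tau>' (s, t0)" if "norm s < r" for s
  proof -
    define z where "z = \<Phi> (s, t0)"
    have p: "(s, t0) \<in> ball 0 r \<times> D" using mem'[OF that t0'] .
    have "((\<lambda>s. eval2 S (\<Phi> (s, t0))) has_field_derivative
        eval2 (D1 S) z * a (s, t0) + eval2 (D2 S) z * a' (s, t0)) (at s)"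
      unfolding z_def by (rule has_field_derivative_eval2[OF partial(1,2)[OF p]])
    moreover have "((\<lambda>s. eval2 S (\<Phi> (s, t0))) has_field_derivative of_nat m * s ^ (m - 1)) (at s)"
    proof (rule has_field_derivative_transform_within_open)
      show "((\<lambda>s. s ^ m) has_field_derivative of_nat m * s ^ (m - 1)) (at s)"
        by (auto intro!: derivative_eq_intros)
      show "open (ball 0 r)" "s \<in> ball 0 r" using that by auto
      show "s ^ m = eval2 S (\<Phi> (s, t0))" if "s \<in> ball 0 r" for s using S\<Phi>[of "(s, t0)"] that t0 by simp
    qed
    ultimately have 1: "eval2 (D1 S) z * a (s, t0) + eval2 (D2 S) z * a' (s, t0) = of_nat m * s ^ (m - 1)"
      by (rule DERIV_unique)
    have "((\<lambda>x. eval2 S (\<Phi> (s, x))) has_field_derivative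
        eval2 (D1 S) z * b (s, t0) + eval2 (D2 S) z * b' (s, t0)) (at t0)"
      unfolding z_def by (rule has_field_derivative_eval2[OF partial(3,4)[OF p]])
    moreover have "((\<lambda>x. eval2 S (\<Phi> (s, x))) has_field_derivative 0) (at t0)"
    proof (rule has_field_derivative_transform_within_open[OF DERIV_const opD t0(1)])
      show "s ^ m = eval2 S (\<Phi> (s, x))" if "x \<in> D" for x using S\<Phi>[of "(s, x)"] that p by simp
    qed
    ultimately have 2: "eval2 (D1 S) z * b (s, t0) + eval2 (D2 S) z * b' (s, t0) = 0"
      by (rule DERIV_unique)
    have "eval2 (jac_poly S T) z * d s
      = (eval2 (D1 S) z * a (s, t0) + eval2 (D2 S) z * a' (s, t0)) * \<tau>' (s, t0)
        - (eval2 (D1 S) z * b (s, t0) + eval2 (D2 S) z * b' (s, t0)) * (eval2 (D1 T) z * a (s, t0) + eval2 (D2 T) z * a' (s, t0))"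
      unfolding jac_poly_def d_def \<tau>'_def z_def eval2_simps by algebra
    then show ?thesis unfolding 1 2 by (simp add: \<zeta>_def z_def)
  qed
  show thesis
  proof
    show "z0 \<in> \<Gamma> - E" by fact
    have "isCont \<Phi> (0, t0)"
      using deriv[OF mem[OF t0(1)]] by (rule has_derivative_continuous)
    moreover have "((\<lambda>s. (s, t0)) \<longlongrightarrow> (0, t0)) (at 0)" by (intro tendsto_intros)
    ultimately show "(\<zeta> \<longlongrightarrow> z0) (at 0)"
      unfolding \<zeta>_def z0_def by (rule isCont_tendsto_compose)
    show "\<forall>\<^sub>F s in at 0. eval2 S (\<zeta> s) = s ^ m"
      using near by eventually_elim (use S\<Phi> mem' t0' in \<open>force simp: \<zeta>_def\<close>)
    have "((\<lambda>s. of_nat m * (\<tau>' (s, t0) / s ^ N) / d s) \<longlongrightarrow> of_nat m * deriv (\<beta> N) t0 / d 0) (at 0)"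
      by (intro tendsto_intros lim\<tau> d d0) (simp add: D)
    moreover have "\<forall>\<^sub>F s in at 0. of_nat m * (\<tau>' (s, t0) / s ^ N) / d s
        = eval2 (jac_poly S T) (\<zeta> s) / s ^ (m - 1 + N)"
      using near eventually_neq_at_within[of 0 0 UNIV]
    proof eventually_elim
      case (elim s)
      have "eval2 (jac_poly S T) (\<zeta> s) = of_nat m * s ^ (m - 1) * \<tau>' (s, t0) / d s"
        using J[OF elim(1)] d0[OF elim(1)] by (simp add: eq_divide_eq)
      then show ?case using elim(2) by (simp add: power_add)
    qed
    ultimately show "((\<lambda>s. eval2 (jac_poly S T) (\<zeta> s) / s ^ (m - 1 + N)) \<longlongrightarrow>
        of_nat m * deriv (\<beta> N) t0 / d 0) (at 0)"
      by (rule Lim_transform_eventually)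
    show "of_nat m * deriv (\<beta> N) t0 / d 0 \<noteq> 0" using m t0 d0[of 0] D(1) by simp
  qed
qed


section \<open>Substitution\<close>

context
  fixes k :: "complex \<Rightarrow> 'a :: comm_ring_1"
  assumes k0: "k 0 = 0" and k1: "k 1 = 1" and kadd: "\<And>a b. k (a + b) = k a + k b"
    and kmult: "\<And>a b. k (a * b) = k a * k b"
begin

private lemma eval_add: "poly (map_poly k (p + q)) u = poly (map_poly k p) u + poly (map_poly k q) u"
  by (induction p q rule: poly_induct2) (simp_all add: map_poly_pCons k0 kadd algebra_simps)

private lemma eval_smult: "poly (map_poly k (smult c p)) u = k c * poly (map_poly k p) u"
  by (induction p) (simp_all add: map_poly_pCons k0 kmult algebra_simps)

private lemma eval_mult: "poly (map_poly k (p * q)) u = poly (map_poly k p) u * poly (map_poly k q) u"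
  by (induction p) (simp_all add: map_poly_pCons k0 eval_add eval_smult algebra_simps)

lemma subst2_add: "subst2 k (A + B) u w = subst2 k A u w + subst2 k B u w"
  by (induction A B rule: poly_induct2) (simp_all add: subst2_pCons[of k, OF k0] eval_add algebra_simps)

lemma subst2_smult: "subst2 k (smult c A) u w = poly (map_poly k c) u * subst2 k A u w"
  by (induction A) (simp_all add: subst2_pCons[of k, OF k0] eval_mult algebra_simps)

lemma subst2_mult: "subst2 k (A * B) u w = subst2 k A u w * subst2 k B u w"
  by (induction A) (simp_all add: subst2_pCons[of k, OF k0] subst2_add subst2_smult k0 algebra_simps)

lemma subst2_const: "subst2 k [:[:c:]:] u w = k c"
  by (simp add: subst2_pCons[of k, OF k0] map_poly_pCons k0)

lemma subst2_Z1: "subst2 k Z1 u w = u"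
  by (simp add: Z1_def subst2_pCons[of k, OF k0] map_poly_pCons k0 k1)

lemma subst2_Z2: "subst2 k Z2 u w = w"
  by (simp add: Z2_def subst2_pCons[of k, OF k0] map_poly_pCons k0 k1 one_pCons)

end

lemma embed_hom:
  "to_fract [:[:0:]:] = 0" "to_fract [:[:1:]:] = 1"
  "to_fract [:[:a + b:]:] = to_fract [:[:a:]:] + to_fract [:[:b:]:]"
  "to_fract [:[:a * b:]:] = to_fract [:[:a:]:] * to_fract [:[:b:]:]"
  for a b :: complex
proof -
  have "[:[:a + b:]:] = [:[:a:]:] + [:[:b:]:]" "[:[:a * b:]:] = [:[:a:]:] * [:[:b:]:]" by simp_all
  then show "to_fract [:[:a + b:]:] = to_fract [:[:a:]:] + to_fract [:[:b:]:]"
    "to_fract [:[:a * b:]:] = to_fract [:[:a:]:] * to_fract [:[:b:]:]"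
    by (simp_all only: to_fract_add to_fract_mult)
qed (simp_all flip: one_pCons)

lemma subst_fract_add: "subst_fract (A + B) u w = subst_fract A u w + subst_fract B u w"
  and subst_fract_mult: "subst_fract (A * B) u w = subst_fract A u w * subst_fract B u w"
  and subst_fract_const: "subst_fract [:[:c:]:] u w = to_fract [:[:c:]:]"
  and subst_fract_Z1: "subst_fract Z1 u w = u"
  and subst_fract_Z2: "subst_fract Z2 u w = w"
  unfolding subst_fract_def
  by (rule subst2_add subst2_mult subst2_const subst2_Z1 subst2_Z2; rule embed_hom)+

lemma subst_fract_1: "subst_fract 1 u w = 1"
  using subst_fract_const[of 1 u w] by (simp flip: one_pCons)

lemma subst_fract_power: "subst_fract (A ^ n) u w = subst_fract A u w ^ n"
  by (induction n) (simp_all add: subst_fract_1 subst_fract_mult)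

text \<open>Constants and the two variables generate the polynomial ring.\<close>

lemma poly2_induct [case_names const Z1 Z2 add mult]:
  assumes const: "\<And>c. P [:[:c:]:]" and "P Z1" "P Z2"
    and add: "\<And>A B. P A \<Longrightarrow> P B \<Longrightarrow> P (A + B)" and mult: "\<And>A B. P A \<Longrightarrow> P B \<Longrightarrow> P (A * B)"
  shows "P (A :: complex poly poly)"
proof (induction A)
  case 0
  then show ?case using const[of 0] by simp
next
  case (pCons c A)
  have "P [:c:]" for c
  proof (induction c)
    case 0
    then show ?case using const[of 0] by simp
  next
    case (pCons a c)
    have eq: "[:pCons a c:] = [:[:a:]:] + Z1 * [:c:]" by (simp add: Z1_def)
    show ?case unfolding eq by (intro add mult const assms(2) pCons.IH)
  qed
  moreover have eq: "pCons c A = [:c:] + Z2 * A" by (simp add: Z2_def)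
  ultimately show ?case unfolding eq by (intro add mult assms(3) pCons.IH)
qed

lemma (in curve) subst_fract_local_ring:
  assumes "u \<in> R" "w \<in> R"
  shows "subst_fract A u w \<in> R"
  by (induction A rule: poly2_induct)
    (simp_all add: subst_fract_const subst_fract_Z1 subst_fract_Z2 subst_fract_add subst_fract_mult
      assms local_ring_to_fract local_ring_add local_ring_mult)


section \<open>The function field extension\<close>

text \<open>Let \<open>L = G * W\<close> be the coordinate minus a constant. Differentiation in the
  other variable kills \<open>L\<close>, and since \<open>G\<close> does not divide that derivative
  of itself, it divides \<open>W\<close>. So \<open>G\<close> divides \<open>L\<close> twice, and
  the derivative of \<open>L\<close> in its own variable, which is 1, would be a multiple of
  \<open>G\<close>.\<close>

lemma (in curve) not_dvd_coordinate:
  assumes "i = (1 :: 2) \<and> q = D2 G \<or> i = 2 \<and> q = D1 G" "\<not> G dvd q"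
  shows "\<not> G dvd (if i = 1 then Z1 else Z2) - [:[:c:]:]"
proof
  have aux: False if "d L = 0" "d' L = 1" "\<not> G dvd d G" "G dvd L"
    and d: "\<And>A B. d (A * B) = d A * B + A * d B" "\<And>A B. d' (A * B) = d' A * B + A * d' B"
    for d d' :: "complex poly poly \<Rightarrow> complex poly poly" and L
  proof -
    obtain W where W: "L = G * W" using \<open>G dvd L\<close> by auto
    then have "d G * W = - (G * d W)" using that(1) d(1) by (simp add: add_eq_0_iff)
    then have "G dvd d G * W" by simp
    then have "G dvd W" using that(3) prime by (simp add: prime_elem_dvd_mult_iff)
    then obtain X where X: "W = G * X" by auto
    have "1 = G * (d' G * X + d' G * X + G * d' X)"
      using that(2) unfolding W X d by (simp add: algebra_simps)
    then show False using not_dvd_1 by (metis dvd_triv_left)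
  qed
  assume "G dvd (if i = 1 then Z1 else Z2) - [:[:c:]:]"
  moreover have "D2 (Z1 - [:[:c:]:]) = 0" "D1 (Z1 - [:[:c:]:]) = 1"
    "D1 (Z2 - [:[:c:]:]) = 0" "D2 (Z2 - [:[:c:]:]) = 1"
    by (simp_all add: Z1_def Z2_def map_poly_pCons pderiv_pCons one_pCons)
  ultimately show False
    using aux[of D2 _ D1] aux[of D1 _ D2] assms D1_mult by (auto simp: pderiv_mult algebra_simps)
qed

lemma eval2_smult: "eval2 (smult c A) z = poly c (z $ 1) * eval2 A z"
  by (simp add: eval2_def)

text \<open>The hypothesis says that the differential of \<open>P/Q\<close> is proportional to
  \<open>dG\<close> on the curve, so \<open>P/Q\<close> has derivative zero along a local
  parametrization. Hence it is a constant \<open>k\<close> there, and \<open>P - k * Q\<close> has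
  infinitely many zeros in common with \<open>G\<close>.\<close>

lemma (in curve) constant_along_curve:
  assumes adapted: "adapted_coordinates {z. eval2 G z = 0} U s t D" and Q: "\<not> G dvd Q"
    and wedge: "G dvd (D1 P * Q - P * D1 Q) * D2 G - (D2 P * Q - P * D2 Q) * D1 G"
  obtains k where "G dvd P - [:[:k:]:] * Q"
proof (rule curve_parametrization[OF adapted])
  fix c \<rho> \<phi> p q
  assume \<rho>: "\<rho> > 0" and inj: "inj_on \<phi> (ball c \<rho>)"
    and \<Gamma>: "\<phi> ` ball c \<rho> \<subseteq> {z. eval2 G z = 0}"
    and p: "\<And>x. x \<in> ball c \<rho> \<Longrightarrow> ((\<lambda>x. \<phi> x $ 1) has_field_derivative p x) (at x)"
    and q: "\<And>x. x \<in> ball c \<rho> \<Longrightarrow> ((\<lambda>x. \<phi> x $ 2) has_field_derivative q x) (at x)"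
    and pq: "\<And>x. x \<in> ball c \<rho> \<Longrightarrow> p x \<noteq> 0 \<or> q x \<noteq> 0"
  \<comment> \<open>A partial derivative of \<open>G\<close> that does not vanish identically on the
    curve. Removing its zeros, along with those of \<open>Q\<close>, keeps \<open>dG\<close> nonzero
    and the punctured disc connected.\<close>
  obtain Dj where Dj: "\<not> G dvd Dj" "Dj = D1 G \<or> Dj = D2 G"
    using irreducible_not_dvd_partials[OF irr] by blast
  define E where "E = {x \<in> ball c \<rho>. eval2 Q (\<phi> x) = 0 \<or> eval2 Dj (\<phi> x) = 0}"
  have "finite {z. eval2 G z = 0 \<and> eval2 (Q * Dj) z = 0}"
    using Q Dj(1) not_dvd_mult finite_common_zeros[OF irr] by blast
  then have "finite (\<phi> -` {z. eval2 G z = 0 \<and> eval2 (Q * Dj) z = 0} \<inter> ball c \<rho>)"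
    using inj by (rule finite_vimage_IntI)
  then have E: "finite E"
    by (rule rev_finite_subset) (use \<Gamma> in \<open>auto simp: E_def image_subset_iff\<close>)
  define X where "X = ball c \<rho> - E"
  have X: "open X" "connected X"
    unfolding X_def using E by (auto intro!: open_Diff finite_imp_closed connected_open_diff_countable
      simp: countable_finite)
  have deriv: "((\<lambda>x. eval2 P (\<phi> x) / eval2 Q (\<phi> x)) has_field_derivative 0) (at x)" if x: "x \<in> X" for x
  proof -
    have b: "x \<in> ball c \<rho>" and nz: "eval2 Q (\<phi> x) \<noteq> 0" "eval2 Dj (\<phi> x) \<noteq> 0"
      using x by (auto simp: X_def E_def)
    define P0 P1 P2 Q0 Q1 Q2 G1 G2 where "P0 = eval2 P (\<phi> x)" and "P1 = eval2 (D1 P) (\<phi> x)"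
      and "P2 = eval2 (D2 P) (\<phi> x)" and "Q0 = eval2 Q (\<phi> x)" and "Q1 = eval2 (D1 Q) (\<phi> x)"
      and "Q2 = eval2 (D2 Q) (\<phi> x)" and "G1 = eval2 (D1 G) (\<phi> x)" and "G2 = eval2 (D2 G) (\<phi> x)"
    note defs = this
    note chain = has_field_derivative_eval2[OF p[OF b] q[OF b]]
    have "((\<lambda>x. eval2 G (\<phi> x)) has_field_derivative 0) (at x)"
      by (rule has_field_derivative_transform_within_open[OF DERIV_const open_ball b, of 0])
        (use \<Gamma> in \<open>auto simp: image_subset_iff\<close>)
    from DERIV_unique[OF this chain[of G]] have G: "G1 * p x + G2 * q x = 0"
      by (simp add: defs)
    have "eval2 G (\<phi> x) = 0" using \<Gamma> b by blast
    then have "eval2 ((D1 P * Q - P * D1 Q) * D2 G - (D2 P * Q - P * D2 Q) * D1 G) (\<phi> x) = 0"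
      using wedge irreducible_dvd_iff_vanishes[OF irr] by blast
    then have wedge': "(P1 * Q0 - P0 * Q1) * G2 = (P2 * Q0 - P0 * Q2) * G1"
      by (simp add: defs)
    \<comment> \<open>\<open>dG\<close> annihilates the velocity \<open>(p x, q x)\<close>, and so
      does any form proportional to the nonzero form \<open>dG\<close>.\<close>
    have "((P1 * Q0 - P0 * Q1) * p x + (P2 * Q0 - P0 * Q2) * q x) * G1 = 0"
      and "((P1 * Q0 - P0 * Q1) * p x + (P2 * Q0 - P0 * Q2) * q x) * G2 = 0"
      using G wedge' by algebra+
    moreover have "G1 \<noteq> 0 \<or> G2 \<noteq> 0" using nz(2) Dj(2) by (auto simp: defs)
    ultimately have zero: "(P1 * Q0 - P0 * Q1) * p x + (P2 * Q0 - P0 * Q2) * q x = 0" by auto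
    have "((\<lambda>x. eval2 P (\<phi> x) / eval2 Q (\<phi> x)) has_field_derivative
      ((P1 * p x + P2 * q x) * Q0 - P0 * (Q1 * p x + Q2 * q x)) / (Q0 * Q0)) (at x)"
      unfolding defs by (rule DERIV_divide[OF chain chain nz(1)])
    moreover have "(P1 * p x + P2 * q x) * Q0 - P0 * (Q1 * p x + Q2 * q x) = 0"
      using zero by (simp add: algebra_simps)
    ultimately show ?thesis by simp
  qed
  have "continuous_on X (\<lambda>x. eval2 P (\<phi> x) / eval2 Q (\<phi> x))"
    using deriv DERIV_isCont continuous_at_imp_continuous_on by blast
  then have "(\<lambda>x. eval2 P (\<phi> x) / eval2 Q (\<phi> x)) constant_on X"
    by (rule DERIV_zero_connected_constant_on[OF X(2,1) finite.emptyI]) (use deriv in simp)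
  then obtain k where k: "\<forall>x\<in>X. eval2 P (\<phi> x) / eval2 Q (\<phi> x) = k"
    unfolding constant_on_def by blast
  have "G dvd P - [:[:k:]:] * Q"
  proof (rule ccontr)
    assume "\<not> ?thesis"
    then have "finite {z. eval2 G z = 0 \<and> eval2 (P - [:[:k:]:] * Q) z = 0}"
      by (rule finite_common_zeros[OF irr])
    moreover have "\<phi> ` X \<subseteq> {z. eval2 G z = 0 \<and> eval2 (P - [:[:k:]:] * Q) z = 0}"
    proof
      fix z assume "z \<in> \<phi> ` X"
      then obtain x where x: "x \<in> X" "z = \<phi> x" by blast
      then have "eval2 Q z \<noteq> 0" "eval2 G z = 0" using \<Gamma> by (auto simp: X_def E_def image_subset_iff)
      then show "z \<in> {z. eval2 G z = 0 \<and> eval2 (P - [:[:k:]:] * Q) z = 0}"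
        using k[rule_format, OF x(1)] x(2) by (simp add: field_simps eval2_smult)
    qed
    ultimately have "finite (\<phi> ` X)" by (rule rev_finite_subset)
    moreover have "inj_on \<phi> X" using inj by (rule inj_on_subset) (auto simp: X_def)
    ultimately have "finite X" by (rule finite_imageD)
    then have "finite (X \<union> E)" using E by simp
    then have "finite (ball c \<rho>)" by (rule rev_finite_subset) (auto simp: X_def)
    then show False using \<rho> uncountable_ball countable_finite by blast
  qed
  then show thesis by (rule that)
qed

lemma (in curve) units_at_numerator:
  assumes "Fract A B \<in> units_at G" "\<not> G dvd B"
  shows "\<not> G dvd A"
proof
  assume "G dvd A"
  obtain C D where CD: "Fract A B = Fract C D" "\<not> G dvd C" "\<not> G dvd D"
    using assms(1) unfolding units_at_def by blast
  then have "A * D = C * B" using assms(2) by (simp add: eq_fract not_dvd_nonzero)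
  then show False using \<open>G dvd A\<close> CD(2) assms(2) not_dvd_mult by (metis dvd_mult2)
qed

lemma zariski_closure_contains: "E \<subseteq> zariski_closure E"
  by (auto simp: zariski_closure_def)

text \<open>\<open>nz\<close> expresses that \<open>F\<close> is dominant; it makes the quotient
  independent of the chosen fraction, so the definite description denotes.\<close>

lemma pullback_Fract:
  assumes nz: "\<And>B. B \<noteq> 0 \<Longrightarrow> subst_fract B (F $ 1) (F $ 2) \<noteq> 0" and "B \<noteq> 0"
  shows "pullback F (Fract A B) = subst_fract A (F $ 1) (F $ 2) / subst_fract B (F $ 1) (F $ 2)"
  unfolding pullback_def
proof (rule the_equality)
  show "\<exists>A' B'. B' \<noteq> 0 \<and> Fract A B = Fract A' B' \<and>
      subst_fract A (F $ 1) (F $ 2) / subst_fract B (F $ 1) (F $ 2)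
      = subst_fract A' (F $ 1) (F $ 2) / subst_fract B' (F $ 1) (F $ 2)"
    using \<open>B \<noteq> 0\<close> by blast
  fix x assume "\<exists>A' B'. B' \<noteq> 0 \<and> Fract A B = Fract A' B' \<and>
      x = subst_fract A' (F $ 1) (F $ 2) / subst_fract B' (F $ 1) (F $ 2)"
  then obtain A' B' where *: "B' \<noteq> 0" "Fract A B = Fract A' B'"
    "x = subst_fract A' (F $ 1) (F $ 2) / subst_fract B' (F $ 1) (F $ 2)" by blast
  then have "A * B' = A' * B" using \<open>B \<noteq> 0\<close> by (simp add: eq_fract)
  then have "subst_fract A (F $ 1) (F $ 2) * subst_fract B' (F $ 1) (F $ 2)
    = subst_fract A' (F $ 1) (F $ 2) * subst_fract B (F $ 1) (F $ 2)"
    by (metis subst_fract_mult)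
  then show "x = subst_fract A (F $ 1) (F $ 2) / subst_fract B (F $ 1) (F $ 2)"
    using nz[OF *(1)] nz[OF \<open>B \<noteq> 0\<close>] by (simp add: *(3) frac_eq_eq)
qed

lemma ramification_index_eq:
  assumes keller: "keller_map f" and V: "irreducible_curve V"
    and \<Gamma>: "curve_over_infinity S T \<Gamma>"
    and dense: "maps_densely_onto (extend_map S T f) \<Gamma> V"
    and rep: "u_gamma_representation S T \<Gamma> m N"
  shows "\<exists>e. int N - 2 * int m = int e \<and>
    ramification_index (pullback (extend_map S T f)) (local_ring V) (local_ring \<Gamma>) e"
proof -
  obtain G where G: "irreducible G" "\<Gamma> = {z. eval2 G z = 0}"
    using \<Gamma> unfolding curve_over_infinity_def irreducible_curve_def by blast
  obtain v where v: "irreducible v" "V = {z. eval2 v z = 0}"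
    using V unfolding irreducible_curve_def by blast
  interpret \<Gamma>: curve G by unfold_locales (fact G(1))
  interpret V: curve v by unfold_locales (fact v(1))
  define F where "F = extend_map S T f"
  define \<Phi> where "\<Phi> A = subst_fract A (F $ 1) (F $ 2)" for A
  have FR: "F $ i \<in> \<Gamma>.R" for i
    using dense unfolding maps_densely_onto_def F_def G(2) by blast
  have closure: "zariski_closure (image_of_curve F \<Gamma>) = V"
    using dense unfolding maps_densely_onto_def F_def by blast
  have \<Phi>R: "\<Phi> A \<in> \<Gamma>.R" for A unfolding \<Phi>_def by (rule \<Gamma>.subst_fract_local_ring[OF FR FR])
  have "\<exists>A B. F $ i = Fract A B \<and> \<not> G dvd B" for i
    using FR[of i] unfolding local_ring_eq[OF G(1)] by blast
  then obtain P Q where PQ: "\<And>i. F $ i = Fract (P i) (Q i)" "\<And>i. \<not> G dvd Q i"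
    by metis
  have val: "has_value (\<Phi> A) z (eval2 A y)" if "\<And>i. has_value (F $ i) z (y $ i)" for A y z
  proof -
    have "vector [y $ 1, y $ 2] = y" by (simp add: vec2_eq_iff)
    then show ?thesis
      using has_value_subst_fract[OF that[of 1] that[of 2], of A] by (simp add: \<Phi>_def)
  qed

  \<comment> \<open>A nonunit would take the value 0 wherever \<open>F\<close> is defined on
    \<open>\<Gamma>\<close>, so \<open>A\<close> would vanish on the image, hence on its closure
    \<open>V\<close>, and \<open>v\<close> would divide it.\<close>
  have unit: "\<Phi> A \<in> units_at G" if "\<not> v dvd A" for A
  proof (rule ccontr)
    assume nu: "\<Phi> A \<notin> units_at G"
    have "eval2 A y = 0" if y: "y \<in> image_of_curve F \<Gamma>" for y
    proof -
      obtain z where z: "z \<in> \<Gamma>" "\<forall>i. has_value (F $ i) z (y $ i)"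
        using y unfolding image_of_curve_def by blast
      have "eval2 G z = 0" using z(1) G(2) by simp
      from \<Gamma>.has_value_nonunit[OF \<Phi>R nu this val[OF z(2)[rule_format]]] show ?thesis .
    qed
    then have "\<forall>y\<in>V. eval2 A y = 0" unfolding closure[symmetric] zariski_closure_def by blast
    then show False using that irreducible_dvd_iff_vanishes[OF v(1)] v(2) by blast
  qed
  \<comment> \<open>A unit has nonzero values at all but finitely many points of
    \<open>\<Gamma>\<close>. Choosing such a point where \<open>F\<close> is defined contradicts the
    vanishing of \<open>A\<close> on \<open>V\<close>.\<close>
  have nonunit: "\<Phi> A \<notin> units_at G" if "v dvd A" for A
  proof
    assume u: "\<Phi> A \<in> units_at G"
    let ?X = "{z. eval2 G z = 0 \<and> \<not> (\<exists>w. w \<noteq> 0 \<and> has_value (\<Phi> A) z w)}"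
    have "finite (?X \<union> {z. eval2 G z = 0 \<and> eval2 (Q 1) z = 0} \<union> {z. eval2 G z = 0 \<and> eval2 (Q 2) z = 0})"
      using \<Gamma>.finite_zeros_unit[OF u] finite_common_zeros[OF G(1) PQ(2)] by blast
    then obtain z where z: "z \<in> \<Gamma>" "z \<notin> ?X" "eval2 (Q 1) z \<noteq> 0" "eval2 (Q 2) z \<noteq> 0"
      using infinite_zeros_irreducible[OF G(1)] unfolding G(2)
      by (smt (verit, ccfv_threshold) UnCI finite_subset mem_Collect_eq subsetI)
    define y :: "complex ^ 2" where "y = (\<chi> i. eval2 (P i) z / eval2 (Q i) z)"
    have "eval2 (Q i) z \<noteq> 0" for i using z exhaust_2[of i] by auto
    then have y: "has_value (F $ i) z (y $ i)" for i
      using has_value_Fract by (simp add: PQ(1) y_def)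
    then have "y \<in> image_of_curve F \<Gamma>" using z(1) unfolding image_of_curve_def by blast
    then have "y \<in> V" using zariski_closure_contains closure by blast
    then have "eval2 A y = 0" using that v irreducible_dvd_iff_vanishes by blast
    with val[OF y] have "has_value (\<Phi> A) z 0" by metis
    then show False using z(1,2) G(2) has_value_unique by blast
  qed

  obtain i :: 2 and q where idx: "i = (1 :: 2) \<and> q = D2 v \<or> i = 2 \<and> q = D1 v" and q: "\<not> v dvd q"
    using irreducible_not_dvd_partials[OF v(1)] by blast
  \<comment> \<open>The numerator of \<open>dF_i\<close> wedge \<open>dG\<close>, with
    \<open>F_i\<close> written as \<open>P i / Q i\<close>.\<close>
  define C where "C = (D1 (P i) * Q i - P i * D1 (Q i)) * D2 G - (D2 (P i) * Q i - P i * D2 (Q i)) * D1 G"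
  obtain X Y where XY: "\<Phi> q = Fract X Y" "\<not> G dvd X" "\<not> G dvd Y"
    using unit[OF q] unfolding units_at_def by blast
  obtain u where u: "u \<in> units_at G" "to_fract S = u * to_fract G ^ m" and m: "m \<ge> 1"
    using rep \<Gamma>.has_order_iff unfolding u_gamma_representation_def G(2) by blast
  obtain A' B' where AB': "u = Fract A' B'" "\<not> G dvd A'" "\<not> G dvd B'"
    using u(1) unfolding units_at_def by blast
  have SAB: "S * B' = A' * G ^ m"
  proof -
    have "to_fract S = Fract (A' * G ^ m) B'"
      unfolding u(2) AB'(1) to_fract_power[symmetric] by (simp add: to_fract_def)
    moreover have "B' \<noteq> 0" using AB'(3) by auto
    ultimately show ?thesis by (simp add: to_fract_def eq_fract)
  qed
  obtain U s t D \<beta> where adapted: "adapted_coordinates {z. eval2 G z = 0} U s t D"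
    and s: "\<forall>z\<in>U. s z ^ m = eval2 S z" and \<beta>: "\<forall>i. \<beta> i holomorphic_on D"
    and sums: "\<forall>z\<in>U. (\<lambda>i. \<beta> i (t z) * s z ^ i) sums eval2 T z"
    and const: "\<forall>i<N. \<beta> i constant_on D" and nonconst: "\<not> \<beta> N constant_on D"
    using rep unfolding u_gamma_representation_def G(2) by blast
  \<comment> \<open>Otherwise \<open>F_i\<close> would be a constant \<open>k\<close> on
    \<open>\<Gamma>\<close> and the coordinate \<open>y_i - k\<close> would pull back to a nonunit,
    although \<open>v\<close> does not divide it.\<close>
  have C: "\<not> G dvd C"
  proof
    assume "G dvd C"
    then obtain k where k: "G dvd P i - [:[:k:]:] * Q i"
      using \<Gamma>.constant_along_curve[OF adapted PQ(2)] unfolding C_def by blast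
    define L where "L = (if i = 1 then Z1 else Z2) - [:[:k:]:]"
    have "\<Phi> (if i = 1 then Z1 else Z2) = F $ i"
      using idx by (auto simp: \<Phi>_def subst_fract_Z1 subst_fract_Z2)
    moreover have "(if i = 1 then Z1 else Z2) = L + [:[:k:]:]" by (simp add: L_def)
    ultimately have "F $ i = \<Phi> L + to_fract [:[:k:]:]"
      by (simp add: \<Phi>_def subst_fract_add subst_fract_const)
    then have "\<Phi> L = Fract (P i) (Q i) - Fract [:[:k:]:] 1"
      by (simp add: PQ(1) to_fract_def eq_diff_eq)
    moreover have "Q i \<noteq> 0" using PQ(2)[of i] by auto
    ultimately have "\<Phi> L = Fract (P i - [:[:k:]:] * Q i) (Q i)" by (simp add: diff_fract)
    then show False
      using V.not_dvd_coordinate[OF idx q, of k] unit[of L] \<Gamma>.units_at_numerator PQ(2) k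
      unfolding L_def by metis
  qed

  \<comment> \<open>Every nonvanishing condition on the base point is encoded in one polynomial
    \<open>M\<close>, whose zeros on \<open>\<Gamma>\<close> are finitely many and can be
    avoided.\<close>
  have generic: "\<exists>z0 \<zeta> c. eval2 G z0 = 0 \<and> eval2 M z0 \<noteq> 0 \<and> (\<zeta> \<longlongrightarrow> z0) (at 0) \<and>
      (\<forall>\<^sub>F s in at 0. eval2 S (\<zeta> s) = s ^ m) \<and>
      ((\<lambda>s. eval2 (jac_poly S T) (\<zeta> s) / s ^ (m - 1 + N)) \<longlongrightarrow> c) (at 0) \<and> c \<noteq> 0"
    if M: "\<not> G dvd M" for M
  proof (rule jacobian_along_curve[OF adapted s[rule_format] \<beta>[rule_format] sums[rule_format] const[rule_format] nonconst m
        finite_common_zeros[OF G(1) M]])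
    fix z0 \<zeta> c
    assume "z0 \<in> {z. eval2 G z = 0} - {z. eval2 G z = 0 \<and> eval2 M z = 0}" "(\<zeta> \<longlongrightarrow> z0) (at 0)"
      "\<forall>\<^sub>F s in at 0. eval2 S (\<zeta> s) = s ^ m"
      "((\<lambda>s. eval2 (jac_poly S T) (\<zeta> s) / s ^ (m - 1 + N)) \<longlongrightarrow> c) (at 0)" "c \<noteq> 0"
    then show ?thesis by blast
  qed
  have q0: "eval2 q (\<chi> i. eval2 (P i) z / eval2 (Q i) z) \<noteq> 0"
    if "\<And>i. eval2 (Q i) z \<noteq> 0" "eval2 X z \<noteq> 0" "eval2 Y z \<noteq> 0" for z
  proof -
    have "has_value (\<Phi> q) z (eval2 q (\<chi> i. eval2 (P i) z / eval2 (Q i) z))"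
      by (rule val) (simp add: PQ(1) has_value_Fract that(1))
    moreover have "has_value (\<Phi> q) z (eval2 X z / eval2 Y z)"
      unfolding XY(1) using that(3) by (rule has_value_Fract)
    ultimately have "eval2 q (\<chi> i. eval2 (P i) z / eval2 (Q i) z) = eval2 X z / eval2 Y z"
      by (rule has_value_unique)
    then show ?thesis using that by simp
  qed
  have Qi: "eval2 (Q i) z \<noteq> 0" if "eval2 (Q 1) z \<noteq> 0" "eval2 (Q 2) z \<noteq> 0" for i z
    using that exhaust_2[of i] by auto
  note PQ' = PQ(1)[unfolded F_def]

  have \<Phi>v0: "\<Phi> v \<noteq> 0"
  proof -
    have "\<not> G dvd Q 1 * Q 2 * X * Y" by (intro \<Gamma>.not_dvd_mult PQ(2) XY)
    from generic[OF this] obtain z0 \<zeta> c where z0: "eval2 (Q 1 * Q 2 * X * Y) z0 \<noteq> 0"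
      and \<zeta>: "(\<zeta> \<longlongrightarrow> z0) (at 0)" "\<forall>\<^sub>F s in at 0. eval2 S (\<zeta> s) = s ^ m"
      and J: "((\<lambda>s. eval2 (jac_poly S T) (\<zeta> s) / s ^ (m - 1 + N)) \<longlongrightarrow> c) (at 0)" "c \<noteq> 0"
      by blast
    have Qz: "eval2 (Q i) z0 \<noteq> 0" for i using z0 Qi by simp
    have "eval2 q (\<chi> i. eval2 (P i) z0 / eval2 (Q i) z0) \<noteq> 0" using z0 by (intro q0 Qz) auto
    from pullback_equation_nonzero[OF keller PQ' Qz idx this \<zeta> J]
    show ?thesis by (simp add: \<Phi>_def F_def)
  qed
  obtain e w where w: "w \<in> units_at G" "\<Phi> v = w * to_fract G ^ e"
    using \<Gamma>.local_ring_decompose[OF \<Phi>R \<Phi>v0] .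
  have e: "e \<ge> 1" using nonunit[of v] w by (cases e) auto
  obtain A B where AB: "w = Fract A B" "\<not> G dvd A" "\<not> G dvd B"
    using w(1) unfolding units_at_def by blast
  \<comment> \<open>The factors of the product ensure in turn that \<open>F\<close> is defined at
    \<open>z0\<close>, that \<open>q\<close> is nonzero at its image, that the units in
    \<open>\<Phi> v\<close> and in \<open>S\<close> are invertible there, and that
    \<open>dF_i\<close> wedge \<open>dG\<close> does not vanish.\<close>
  have "m - 1 + N = 3 * m + (e - 1)"
  proof -
    have "\<not> G dvd Q 1 * Q 2 * X * Y * A * B * A' * B' * C"
      by (intro \<Gamma>.not_dvd_mult PQ(2) XY AB AB' C)
    from generic[OF this] obtain z0 \<zeta> c where z0: "eval2 G z0 = 0" "eval2 (Q 1 * Q 2 * X * Y * A * B * A' * B' * C) z0 \<noteq> 0"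
      and \<zeta>: "(\<zeta> \<longlongrightarrow> z0) (at 0)" "\<forall>\<^sub>F s in at 0. eval2 S (\<zeta> s) = s ^ m"
      and J: "((\<lambda>s. eval2 (jac_poly S T) (\<zeta> s) / s ^ (m - 1 + N)) \<longlongrightarrow> c) (at 0)" "c \<noteq> 0"
      by blast
    have Qz: "eval2 (Q i) z0 \<noteq> 0" for i using z0(2) Qi by simp
    have qz: "eval2 q (\<chi> i. eval2 (P i) z0 / eval2 (Q i) z0) \<noteq> 0" using z0(2) by (intro q0 Qz) auto
    have h: "subst_fract v (extend_map S T f $ 1) (extend_map S T f $ 2) = Fract A B * to_fract G ^ e"
      using w(2) by (simp add: \<Phi>_def F_def AB(1))
    have nz: "eval2 A z0 \<noteq> 0" "eval2 B z0 \<noteq> 0" "eval2 A' z0 \<noteq> 0" "eval2 B' z0 \<noteq> 0" "eval2 C z0 \<noteq> 0"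
      using z0(2) by auto
    have "quot_grad1 (P i) (Q i) z0 * eval2 (D2 G) z0 - quot_grad2 (P i) (Q i) z0 * eval2 (D1 G) z0
      = eval2 C z0 / eval2 (Q i) z0 ^ 2"
      by (simp add: quot_grad1_def quot_grad2_def C_def diff_divide_distrib left_diff_distrib)
    then have wedge: "quot_grad1 (P i) (Q i) z0 * eval2 (D2 G) z0 - quot_grad2 (P i) (Q i) z0 * eval2 (D1 G) z0 \<noteq> 0"
      using nz(5) Qz by simp
    show ?thesis
      using ramification_exponent[OF keller PQ' Qz idx qz \<zeta> J h nz(1,2) z0(1) wedge SAB nz(3,4) m e] .
  qed
  then have exponent: "int N - 2 * int m = int e" using m e by linarith

  \<comment> \<open>Dominance of \<open>F\<close>: splitting off the powers of \<open>v\<close>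
    leaves a factor that pulls back to a unit, and \<open>\<Phi> v\<close> is nonzero.\<close>
  have \<Phi>_nonzero: "\<Phi> B \<noteq> 0" if B: "B \<noteq> 0" for B
  proof -
    obtain n B' where B': "B = v ^ n * B'" "\<not> v dvd B'" using B by (rule V.poly_decompose)
    have "\<Phi> B = \<Phi> v ^ n * \<Phi> B'" by (simp add: B'(1) \<Phi>_def subst_fract_mult subst_fract_power)
    then show ?thesis using \<Phi>v0 \<Gamma>.units_at_nonzero[OF unit[OF B'(2)]] by simp
  qed
  have pb: "pullback F (Fract A B) = \<Phi> A / \<Phi> B" if "B \<noteq> 0" for A B
    unfolding \<Phi>_def using \<Phi>_nonzero that by (intro pullback_Fract) (simp_all add: \<Phi>_def)
  have "ramification_index (pullback F) (local_ring V) (local_ring \<Gamma>) e"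
    unfolding ramification_index_def v(2) G(2)
  proof (intro conjI)
    show "dvr V.R" by (fact V.dvr_local_ring)
    show "dvr \<Gamma>.R" by (fact \<Gamma>.dvr_local_ring)
    have pbR: "pullback F (Fract A B) \<in> \<Gamma>.R" if "\<not> v dvd B" for A B
    proof -
      have "B \<noteq> 0" using that by auto
      moreover have "inverse (\<Phi> B) \<in> \<Gamma>.R"
        using \<Gamma>.units_at_inverse[OF unit[OF that]] \<Gamma>.units_at_subset by blast
      ultimately show ?thesis
        using \<Gamma>.local_ring_mult[OF \<Phi>R] by (simp add: pb divide_inverse)
    qed
    show "pullback F ` V.R \<subseteq> \<Gamma>.R"
      using pbR unfolding local_ring_eq[OF v(1)] by blast
    show "pullback F ` (V.R - ring_units V.R) \<subseteq> \<Gamma>.R - ring_units \<Gamma>.R"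
      unfolding V.ring_units_local_ring \<Gamma>.ring_units_local_ring
    proof
      fix x assume "x \<in> pullback F ` (V.R - units_at v)"
      then obtain A B where AB: "x = pullback F (Fract A B)" "\<not> v dvd B" "Fract A B \<notin> units_at v"
        unfolding local_ring_eq[OF v(1)] by blast
      then have "v dvd A" using V.units_atI by blast
      have "B \<noteq> 0" using AB(2) by auto
      then have x: "\<Phi> A = x * \<Phi> B" using AB(1) \<Phi>_nonzero[of B] by (simp add: pb)
      have "x \<notin> units_at G"
        using nonunit[OF \<open>v dvd A\<close>] \<Gamma>.units_at_mult unit[OF AB(2)] unfolding x by blast
      then show "x \<in> \<Gamma>.R - units_at G" using pbR[OF AB(2)] AB(1) by blast
    qed
    show "\<exists>p. uniformizer V.R p \<and> has_order \<Gamma>.R (pullback F p) e"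
    proof (intro exI conjI)
      show "uniformizer V.R (to_fract v)" by (rule V.uniformizer_g)
      have "pullback F (to_fract v) = \<Phi> v"
        using pb[of 1 v] by (simp add: to_fract_def \<Phi>_def subst_fract_1)
      then show "has_order \<Gamma>.R (pullback F (to_fract v)) e"
        unfolding \<Gamma>.has_order_iff using w by auto
    qed
  qed
  then show ?thesis using exponent unfolding F_def by blast
qed


section \<open>Linear changes of the target coordinates\<close>

text \<open>Polynomial identities for linear substitutions can thereby be checked pointwise.\<close>

lemma eval2_eq_0: "(\<And>z. eval2 A z = 0) \<Longrightarrow> A = 0"
proof (rule ccontr)
  assume *: "\<And>z. eval2 A z = 0" and "A \<noteq> 0"
  have "map_poly (\<lambda>c. poly c a) A = 0" for a
    using *[of "vector [a, b]" for b] by (simp add: eval2_fibre poly_all_0_iff_0[symmetric])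
  then have "poly (coeff A n) a = 0" for n a
    using coeff_map_poly[of "\<lambda>c. poly c a" A n] by simp
  then have "coeff A n = 0" for n using poly_all_0_iff_0 by blast
  then show False using \<open>A \<noteq> 0\<close> by (simp add: poly_eq_iff)
qed

lemma eval2_eq_iff: "A = B \<longleftrightarrow> (\<forall>z. eval2 A z = eval2 B z)"
  using eval2_eq_0[of "A - B"] by auto

definition linear_subst :: "complex ^ 2 ^ 2 \<Rightarrow> complex poly poly \<Rightarrow> complex poly poly" where
  "linear_subst M A = subst_poly A ([:[:M $ 1 $ 1:]:] * Z1 + [:[:M $ 1 $ 2:]:] * Z2)
     ([:[:M $ 2 $ 1:]:] * Z1 + [:[:M $ 2 $ 2:]:] * Z2)"

lemma eval2_linear_subst: "eval2 (linear_subst M A) y = eval2 A (M *v y)"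
proof -
  have subst: "eval2 (subst_poly A U W) y = eval2 A (vector [eval2 U y, eval2 W y])" for U W
    unfolding subst_poly_def
  proof (induction A)
    case (pCons c A)
    have "eval2 (poly (map_poly (\<lambda>c. [:[:c:]:]) c) U) y = poly c (eval2 U y)"
      by (induction c) (simp_all add: map_poly_pCons)
    with pCons show ?case by (simp add: subst2_pCons eval2_pCons)
  qed simp
  have "vector [eval2 ([:[:M $ 1 $ 1:]:] * Z1 + [:[:M $ 1 $ 2:]:] * Z2) y,
      eval2 ([:[:M $ 2 $ 1:]:] * Z1 + [:[:M $ 2 $ 2:]:] * Z2) y] = M *v y"
    by (simp only: vec2_eq_iff vector_2 matrix_vector_mult_def vec_lambda_beta sum_2 eval2_simps)
  then show ?thesis unfolding linear_subst_def subst by simp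
qed

context
  fixes L M :: "complex ^ 2 ^ 2"
  assumes left_inv: "M ** L = mat 1" and right_inv: "L ** M = mat 1"
begin

lemma inverse_vec: "M *v (L *v y) = y" "L *v (M *v y) = y"
  by (simp_all add: matrix_vector_mul_assoc left_inv right_inv)

text \<open>Substitution by an invertible matrix is a ring automorphism, inverted by substitution of
  the inverse matrix.\<close>

lemma irreducible_linear_subst:
  assumes "irreducible A"
  shows "irreducible (linear_subst M A)"
proof -
  have inv: "linear_subst L (linear_subst M B) = B" "linear_subst M (linear_subst L B) = B" for B
    by (simp_all add: eval2_eq_iff eval2_linear_subst inverse_vec)
  have mult: "linear_subst K (B * C) = linear_subst K B * linear_subst K C" for K B C
    by (simp add: eval2_eq_iff eval2_linear_subst)
  have one: "linear_subst K 1 = 1" "linear_subst K 0 = 0" for K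
    by (simp_all add: eval2_eq_iff eval2_linear_subst)
  have unit: "linear_subst K B dvd 1" if "B dvd 1" for K B
    using that one(1) mult by (metis dvd_def)
  show ?thesis
  proof (rule irreducibleI)
    show "linear_subst M A \<noteq> 0" using assms inv(1)[of A] one(2) by auto
    show "\<not> linear_subst M A dvd 1" using assms unit[of "linear_subst M A" L] inv(1) irreducible_not_unit by metis
    fix B C assume "linear_subst M A = B * C"
    then have "A = linear_subst L B * linear_subst L C" using inv(1) mult by metis
    then have "linear_subst L B dvd 1 \<or> linear_subst L C dvd 1" using assms irreducibleD by blast
    then show "B dvd 1 \<or> C dvd 1" using unit inv(2) by metis
  qed
qed

lemma irreducible_curve_linear:
  assumes "irreducible_curve V"
  shows "irreducible_curve ((\<lambda>y. L *v y) ` V)"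
proof -
  obtain v where v: "irreducible v" "V = {z. eval2 v z = 0}"
    using assms unfolding irreducible_curve_def by blast
  have "(\<lambda>y. L *v y) ` V = {z. eval2 (linear_subst M v) z = 0}"
  proof (intro equalityI subsetI)
    fix z assume "z \<in> {z. eval2 (linear_subst M v) z = 0}"
    then show "z \<in> (\<lambda>y. L *v y) ` V"
      by (intro image_eqI[of _ _ "M *v z"]) (simp_all add: v(2) eval2_linear_subst inverse_vec)
  qed (auto simp: v(2) eval2_linear_subst inverse_vec)
  then show ?thesis
    using irreducible_linear_subst[OF v(1)] unfolding irreducible_curve_def by blast
qed

lemma zariski_closure_linear:
  "zariski_closure ((\<lambda>y. L *v y) ` E) = (\<lambda>y. L *v y) ` zariski_closure E"
proof (intro equalityI subsetI)
  fix y assume y: "y \<in> zariski_closure ((\<lambda>y. L *v y) ` E)"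
  have "eval2 A (M *v y) = 0" if "\<forall>z\<in>E. eval2 A z = 0" for A
  proof -
    have "\<forall>z\<in>(\<lambda>y. L *v y) ` E. eval2 (linear_subst M A) z = 0"
      using that by (simp add: eval2_linear_subst inverse_vec)
    then have "eval2 (linear_subst M A) y = 0" using y unfolding zariski_closure_def by blast
    then show ?thesis by (simp add: eval2_linear_subst)
  qed
  then have "M *v y \<in> zariski_closure E" unfolding zariski_closure_def by blast
  then show "y \<in> (\<lambda>y. L *v y) ` zariski_closure E"
    by (intro image_eqI[of _ _ "M *v y"]) (simp_all add: inverse_vec)
next
  fix y assume "y \<in> (\<lambda>y. L *v y) ` zariski_closure E"
  then obtain x where x: "y = L *v x" "x \<in> zariski_closure E" by blast
  have "eval2 A y = 0" if "\<forall>z\<in>(\<lambda>y. L *v y) ` E. eval2 A z = 0" for A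
  proof -
    have "\<forall>z\<in>E. eval2 (linear_subst L A) z = 0" using that by (simp add: eval2_linear_subst)
    then have "eval2 (linear_subst L A) x = 0" using x(2) unfolding zariski_closure_def by blast
    then show ?thesis by (simp add: x(1) eval2_linear_subst)
  qed
  then show "y \<in> zariski_closure ((\<lambda>y. L *v y) ` E)" unfolding zariski_closure_def by blast
qed

end

section \<open>Composition of the map with a linear automorphism of the target\<close>

lemma linear_comp_nth:
  "linear_comp L f $ i = [:[:L $ i $ 1:]:] * f $ 1 + [:[:L $ i $ 2:]:] * f $ 2"
  by (simp add: linear_comp_def sum_2)

lemma linear_comp_inverse:
  assumes "M ** L = mat 1"
  shows "linear_comp M (linear_comp L f) = f"
proof -
  have *: "M $ i $ 1 * L $ 1 $ j + M $ i $ 2 * L $ 2 $ j = (if i = j then 1 else 0)" for i j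
    using arg_cong[OF assms, of "\<lambda>A. A $ i $ j"] by (simp add: matrix_matrix_mult_def sum_2 mat_def)
  have "eval2 (linear_comp M (linear_comp L f) $ i) z
    = (M $ i $ 1 * L $ 1 $ 1 + M $ i $ 2 * L $ 2 $ 1) * eval2 (f $ 1) z
    + (M $ i $ 1 * L $ 1 $ 2 + M $ i $ 2 * L $ 2 $ 2) * eval2 (f $ 2) z" for i z
    unfolding linear_comp_nth eval2_simps by (simp add: algebra_simps)
  then have "eval2 (linear_comp M (linear_comp L f) $ i) z = eval2 (f $ i) z" for i z
    unfolding * using exhaust_2[of i] by auto
  then have "linear_comp M (linear_comp L f) $ i = f $ i" for i
    by (simp add: eval2_eq_iff)
  then show ?thesis by (simp add: vec_eq_iff)
qed

lemma keller_map_linear_comp: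
  assumes "keller_map f" "det L = 1"
  shows "keller_map (linear_comp L f)"
proof -
  have d1: "D1 ([:[:c:]:] * A) = [:[:c:]:] * D1 A" and d2: "D2 ([:[:c:]:] * A) = [:[:c:]:] * D2 A" for c A
    by (simp_all add: D1_smult pderiv_smult)
  have det: "L $ 1 $ 1 * L $ 2 $ 2 - L $ 1 $ 2 * L $ 2 $ 1 = 1" using assms(2) by (simp add: det_2)
  have f: "D1 (f $ 1) * D2 (f $ 2) - D2 (f $ 1) * D1 (f $ 2) = 1"
    using assms(1) by (simp add: keller_map_def)
  let ?g = "linear_comp L f"
  have "eval2 (D1 (?g $ 1) * D2 (?g $ 2) - D2 (?g $ 1) * D1 (?g $ 2)) z = eval2 1 z" for z
  proof -
    have "eval2 (D1 (?g $ 1) * D2 (?g $ 2) - D2 (?g $ 1) * D1 (?g $ 2)) z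
      = (L $ 1 $ 1 * L $ 2 $ 2 - L $ 1 $ 2 * L $ 2 $ 1)
        * eval2 (D1 (f $ 1) * D2 (f $ 2) - D2 (f $ 1) * D1 (f $ 2)) z"
      unfolding linear_comp_nth D1_add pderiv_add d1 d2 eval2_simps by algebra
    then show ?thesis by (simp only: det f mult_1)
  qed
  then show ?thesis unfolding keller_map_def eval2_eq_iff by blast
qed

lemma extend_map_linear_comp:
  "extend_map S T (linear_comp L f) $ i
    = to_fract [:[:L $ i $ 1:]:] * extend_map S T f $ 1 + to_fract [:[:L $ i $ 2:]:] * extend_map S T f $ 2"
  by (simp only: extend_map_def vec_lambda_beta linear_comp_nth subst_fract_add subst_fract_mult
      subst_fract_const)

lemma has_value_linear_comp:
  assumes "\<And>i. has_value (extend_map S T f $ i) z (y $ i)"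
  shows "has_value (extend_map S T (linear_comp L f) $ i) z ((L *v y) $ i)"
proof -
  have "has_value (extend_map S T (linear_comp L f) $ i) z
    (eval2 [:[:L $ i $ 1:]:] z * y $ 1 + eval2 [:[:L $ i $ 2:]:] z * y $ 2)"
    unfolding extend_map_linear_comp by (intro has_value_add has_value_mult has_value_to_fract assms)
  then show ?thesis by (simp add: matrix_vector_mult_def sum_2)
qed

text \<open>Values transform by \<open>L\<close> in one direction; the other inclusion is the same
  statement for \<open>M\<close> applied to \<open>linear_comp L f\<close>.\<close>

lemma image_of_curve_linear_comp:
  assumes left_inv: "M ** L = mat 1" and right_inv: "L ** M = mat 1"
  shows "image_of_curve (extend_map S T (linear_comp L f)) \<Gamma>
    = (\<lambda>y. L *v y) ` image_of_curve (extend_map S T f) \<Gamma>"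
proof (intro equalityI subsetI)
  fix y assume "y \<in> image_of_curve (extend_map S T (linear_comp L f)) \<Gamma>"
  then obtain z where z: "z \<in> \<Gamma>" "\<forall>i. has_value (extend_map S T (linear_comp L f) $ i) z (y $ i)"
    unfolding image_of_curve_def by blast
  from has_value_linear_comp[OF z(2)[rule_format], of M]
  have "M *v y \<in> image_of_curve (extend_map S T f) \<Gamma>"
    using z(1) unfolding linear_comp_inverse[OF left_inv] image_of_curve_def by blast
  then show "y \<in> (\<lambda>y. L *v y) ` image_of_curve (extend_map S T f) \<Gamma>"
    by (intro image_eqI[of _ _ "M *v y"]) (simp_all add: inverse_vec[OF left_inv right_inv])
next
  fix y assume "y \<in> (\<lambda>y. L *v y) ` image_of_curve (extend_map S T f) \<Gamma>"
  then obtain x z where x: "y = L *v x" "z \<in> \<Gamma>" "\<forall>i. has_value (extend_map S T f $ i) z (x $ i)"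
    unfolding image_of_curve_def by blast
  from has_value_linear_comp[OF x(3)[rule_format], of L]
  show "y \<in> image_of_curve (extend_map S T (linear_comp L f)) \<Gamma>"
    using x(1,2) unfolding image_of_curve_def by blast
qed

lemma maps_densely_onto_linear_comp:
  assumes "irreducible_curve \<Gamma>" and dense: "maps_densely_onto (extend_map S T f) \<Gamma> V"
    and left_inv: "M ** L = mat 1" and right_inv: "L ** M = mat 1"
  shows "maps_densely_onto (extend_map S T (linear_comp L f)) \<Gamma> ((\<lambda>y. L *v y) ` V)"
proof -
  obtain G where G: "irreducible G" "\<Gamma> = {z. eval2 G z = 0}"
    using assms(1) unfolding irreducible_curve_def by blast
  interpret curve G by unfold_locales (fact G(1))
  have "extend_map S T (linear_comp L f) $ i \<in> local_ring \<Gamma>" for i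
    using dense unfolding maps_densely_onto_def extend_map_linear_comp G(2)
    by (blast intro: local_ring_add local_ring_mult local_ring_to_fract)
  then show ?thesis
    using dense unfolding maps_densely_onto_def
    by (simp add: image_of_curve_linear_comp[OF left_inv right_inv] zariski_closure_linear[OF left_inv right_inv])
qed

theorem theorem18:
  fixes f :: "complex poly poly ^ 2"
    and V \<Gamma> :: "(complex ^ 2) set"
    and S T :: "complex poly poly"
    and m N :: nat
    and K :: int
  assumes "keller_map f"
    and "irreducible_component (nonproper_set f) V"
    and "irreducible_curve V"
    and "blowup_chart S T"
    and "curve_over_infinity S T \<Gamma>"
    and "maps_densely_onto (extend_map S T f) \<Gamma> V"
    and "u_gamma_representation S T \<Gamma> m N"
    and "K = int N - 2 * int m"
  shows "finite {L :: complex ^ 2 ^ 2. rotation_matrix L \<and>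
           \<not> (\<exists>e. K = int e \<and>
                 ramification_index (pullback (extend_map S T (linear_comp L f)))
                   (local_ring ((\<lambda>y. L *v y) ` V)) (local_ring \<Gamma>) e)}"
proof -
  \<comment> \<open>The \<open>u\<close>-\<open>\<gamma>\<close> representation lives on the source
    side, so \<open>m\<close>, \<open>N\<close> and \<open>K\<close> are the same for every
    \<open>L\<close>. Only the Keller condition and the image curve must be transported, with
    \<open>transpose L\<close> as inverse.\<close>
  have "\<exists>e. K = int e \<and> ramification_index (pullback (extend_map S T (linear_comp L f)))
      (local_ring ((\<lambda>y. L *v y) ` V)) (local_ring \<Gamma>) e" if L: "rotation_matrix L" for L :: "complex ^ 2 ^ 2"
  proof -
    have inv: "transpose L ** L = mat 1" "L ** transpose L = mat 1" and det: "det L = 1"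
      using L by (auto simp: rotation_matrix_def orthogonal_matrix_def)
    have \<Gamma>: "irreducible_curve \<Gamma>" using assms(5) by (simp add: curve_over_infinity_def)
    show ?thesis
      unfolding assms(8)
      using keller_map_linear_comp[OF assms(1) det] irreducible_curve_linear[OF inv assms(3)] assms(5)
        maps_densely_onto_linear_comp[OF \<Gamma> assms(6) inv] assms(7)
      by (rule ramification_index_eq)
  qed
  then have "{L :: complex ^ 2 ^ 2. rotation_matrix L \<and>
      \<not> (\<exists>e. K = int e \<and> ramification_index (pullback (extend_map S T (linear_comp L f)))
        (local_ring ((\<lambda>y. L *v y) ` V)) (local_ring \<Gamma>) e)} = {}" by blast
  then show ?thesis by (metis finite.emptyI)
qed

end
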